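(* Let $\Theta$ be any functional that on input a Baire 1 function $f:[0,1]\to\mathbb R$, its oscillation function $\mathrm{osc}_{f}$, and $n\in\mathbb N$, outputs an (R.2)-representation of the open set $[0,1]\setminus D_{n}$, where $D_{n}:=\{x\in[0,1]:\mathrm{osc}_{f}(x)\geq\frac{1}{2^{n}}\}$. Then: (1) $\Theta$ together with $\exists^{2}$ computes a Baire realiser. (2) $\Theta$ together with $\exists^2$ and the functional $\Delta$, which converts (R.2)-representations of open sets into (R.3)-representations, computes a finiteness realiser $\Omega_{\mathrm{fin}}$.
   Context: Metatheory: ZFC. Types and coding. Type $0$ is $\mathbb N$, type $1$ is $\mathbb N\to\mathbb N$, type $n+1$ is the type of maps from type $n$ objects to $\mathbb N$. Real numbers are coded by fast-converging Cauchy sequences of rationals, i.e. by type $1$ objects $(q_n)$ with $|q_n-q_{n+i}|<2^{-n}$. Functions $\mathbb R\to\mathbb R$ (or $[0,1]\to\mathbb R$, $[0,1]\to\mathbb N$) are given by maps on codes that send codes of equal reals to codes of equal reals (respectively to equal numbers). Subsets of $\mathbb R$ or $[0,1]$ are given by their characteristic functions, and no further information. When a functional outputs a real, it outputs a code for it. Computability is Kleene's S1-S9. The relation $\{e\}(\vec\Phi)=m$ ($e,m\in\mathbb N$, $\vec\Phi$ a finite list of finite-type objects) is inductively generated by: S1 successor $\{e\}(n,\vec\Phi)=n+1$; S2 constants; S3 projection $\{e\}(n,\vec\Phi)=n$; S4 composition $\{e\}(\vec\Phi)=\{e_1\}(\{e_2\}(\vec\Phi),\vec\Phi)$; S5 primitive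 recursion on $\mathbb N$; S6 permutation of arguments; S7 application of type $1$ arguments $\{e\}(f,n,\vec\Phi)=f(n)$; S8 $\{e\}(\Psi,\vec\Phi)=\Psi(\lambda\phi.\{d\}(\phi,\Psi,\vec\Phi))$ for $\Psi$ of type $k+2$, $\phi$ of type $k$; S9 $\{e\}(d,\vec\Phi,\vec\Psi)=\{d\}(\vec\Phi)$ (indices $e$ code the scheme and its parameters in a standard way). Oracles may be partial functionals: an S8 step is then defined exactly when $\lambda\phi.\{d\}(\phi,\Psi,\vec\Phi)$ is total and lies in the domain of $\Psi$. (The paper uses a lambda calculus with least fixed point operators that captures exactly S1-S9 on total objects and accommodates partial ones.) Functionals with outputs of higher type, such as reals or functions on reals, are computed argumentwise. "Computes" means: there is an index $e$, independent of the given functionals, such that $\{e\}$ applied to the given functionals is a functional of the stated kind. Kleene's $\exists^2$ is the type $2$ functional $\varphi$ with $\varphi(f)=0$ if $(\exists n)(f(n)=0)$ and $\varphi(f)=1$ otherwise. A function $f:[0,1]\to\mathbb R$ is Baire 1 if it is the pointwise limit of a sequence of continuous functions. Oscillation: $\mathrm{osc}_f([a,b])=\sup_{x\in[a,b]}f(x)-\inf_{x\in[a,b]}f(x)$ (and likewise for balls) and $\mathrm{osc}_f(x)=\lim_{k\to\infty}\mathrm{osc}_f(B(x,2^{-k}))$, balls being taken within the domain. A set $O$ is open if each $x\in O$ has some $k\in\mathbb N$ with $B(x,2^{-k})\subset O$ (relative to $[0,1]$ for subsets of $[0,1]$). Representations of an open set $O\subset[0,1]$: (R.2) a function $Y:[0,1]\to[0,1]$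 such that $O=\{x: Y(x)>0\}$ and, whenever $Y(x)>0$, $(x-Y(x),x+Y(x))\cap[0,1]\subseteq O$. (R.3) the continuous function $Y$ where $Y(x)$ is the distance from $x$ to $[0,1]\setminus O$ if the latter is non-empty, and $Y$ is constant $1$ if $O=[0,1]$. $\Delta$ is the (partial) functional that on input an (R.2)-representation of an open set $O$ outputs the (R.3)-representation of $O$. A Baire realiser is a functional $\xi$ such that if $(O_n)_{n\in\mathbb N}$ is a sequence of dense open sets of reals, then $\xi(\lambda n.O_n)\in\bigcap_{n\in\mathbb N}O_n$. A finiteness realiser $\Omega_{\mathrm{fin}}$ is a functional that is defined whenever the input $X\subset\mathbb R$ is finite, and $\Omega_{\mathrm{fin}}(X)$ then is a finite sequence of reals that includes all elements of $X$. *)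

theory Defs
  imports "HOL-Analysis.Analysis" "HOL-Library.Nat_Bijection" "HOL-Library.Countable"
begin

text \<open>
  Arguments of pure type at most 3.  This fragment is closed under the schemes, since S8 only
  introduces arguments of type \<open>k\<close> for an argument of type \<open>k + 2\<close>.  Functionals of type 2 and 3
  may be partial, but they are only ever applied to total arguments.
\<close>

type_synonym type1 = "nat \<Rightarrow> nat"
type_synonym type2 = "type1 \<Rightarrow> nat"

datatype obj =
    T0 nat
  | T1 type1
  | T2 "type1 \<Rightarrow> nat option"
  | T3 "type2 \<Rightarrow> nat option"

text \<open>
  \<open>kleene_rel e \<Phi> m\<close> is \<open>{e}(\<Phi>) = m\<close>.  An index is the number of a list whose head is the number of
  the scheme and whose remaining entries are its parameters.  S6 permits an arbitrary permutation,
  given by the list of positions; the parameter of S9 is the number of arguments that are kept.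
\<close>

inductive kleene_rel :: "nat \<Rightarrow> obj list \<Rightarrow> nat \<Rightarrow> bool" where
  S1: "kleene_rel (list_encode [1]) (T0 n # \<Phi>) (Suc n)"
| S2: "kleene_rel (list_encode [2, c]) \<Phi> c"
| S3: "kleene_rel (list_encode [3]) (T0 n # \<Phi>) n"
| S4: "kleene_rel e2 \<Phi> n \<Longrightarrow> kleene_rel e1 (T0 n # \<Phi>) m
       \<Longrightarrow> kleene_rel (list_encode [4, e1, e2]) \<Phi> m"
| S5_zero: "kleene_rel e1 \<Phi> m \<Longrightarrow> kleene_rel (list_encode [5, e1, e2]) (T0 0 # \<Phi>) m"
| S5_Suc: "kleene_rel (list_encode [5, e1, e2]) (T0 n # \<Phi>) r
       \<Longrightarrow> kleene_rel e2 (T0 n # T0 r # \<Phi>) m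
       \<Longrightarrow> kleene_rel (list_encode [5, e1, e2]) (T0 (Suc n) # \<Phi>) m"
| S6: "distinct p \<Longrightarrow> set p = {..<length \<Phi>} \<Longrightarrow> kleene_rel d (map (\<lambda>i. \<Phi> ! i) p) m
       \<Longrightarrow> kleene_rel (list_encode [6, list_encode p, d]) \<Phi> m"
| S7: "kleene_rel (list_encode [7]) (T1 f # T0 n # \<Phi>) (f n)"
| S8_2: "(\<And>n. kleene_rel d (T0 n # T2 \<Psi> # \<Phi>) (g n)) \<Longrightarrow> \<Psi> g = Some m
       \<Longrightarrow> kleene_rel (list_encode [8, d]) (T2 \<Psi> # \<Phi>) m"
| S8_3: "(\<And>f. kleene_rel d (T1 f # T3 \<Psi> # \<Phi>) (G f)) \<Longrightarrow> \<Psi> G = Some m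
       \<Longrightarrow> kleene_rel (list_encode [8, d]) (T3 \<Psi> # \<Phi>) m"
| S9: "kleene_rel d \<Phi> m
       \<Longrightarrow> kleene_rel (list_encode [9, length \<Phi>]) (T0 d # \<Phi> @ \<Psi>) m"

lemma kleene_rel_unique:
  "kleene_rel e \<Phi> m \<Longrightarrow> kleene_rel e \<Phi> m' \<Longrightarrow> m = m'"
proof (induction arbitrary: m' rule: kleene_rel.induct)
  case (S1 n \<Phi>)
  then show ?case by (cases rule: kleene_rel.cases) (auto simp del: list_encode.simps simp: list_encode_eq)
next
  case (S2 c \<Phi>)
  then show ?case by (cases rule: kleene_rel.cases) (auto simp del: list_encode.simps simp: list_encode_eq)
next
  case (S3 n \<Phi>)
  then show ?case by (cases rule: kleene_rel.cases) (auto simp del: list_encode.simps simp: list_encode_eq)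
next
  case (S4 e2 \<Phi> n e1 m)
  from S4.prems show ?case
    by (cases rule: kleene_rel.cases)
      (auto simp del: list_encode.simps simp: list_encode_eq dest!: S4.IH)
next
  case (S5_zero e1 \<Phi> m e2)
  from S5_zero.prems show ?case
    by (cases rule: kleene_rel.cases)
      (auto simp del: list_encode.simps simp: list_encode_eq dest!: S5_zero.IH)
next
  case (S5_Suc e1 e2 n \<Phi> r m)
  from S5_Suc.prems show ?case
    by (cases rule: kleene_rel.cases)
      (auto simp del: list_encode.simps simp: list_encode_eq dest!: S5_Suc.IH)
next
  case (S6 p \<Phi> d m)
  from S6.prems show ?case
    by (cases rule: kleene_rel.cases)
      (auto simp del: list_encode.simps simp: list_encode_eq dest!: S6.IH)
next
  case (S7 f n \<Phi>)
  then show ?case by (cases rule: kleene_rel.cases) (auto simp del: list_encode.simps simp: list_encode_eq)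
next
  case (S8_2 d \<Psi> \<Phi> g m)
  from S8_2.prems obtain g' where "\<And>n. kleene_rel d (T0 n # T2 \<Psi> # \<Phi>) (g' n)" "\<Psi> g' = Some m'"
    by (cases rule: kleene_rel.cases) (auto simp del: list_encode.simps simp: list_encode_eq)
  moreover from this have "g = g'" by (intro ext S8_2.IH) blast
  ultimately show ?case using S8_2.hyps by simp
next
  case (S8_3 d \<Psi> \<Phi> G m)
  from S8_3.prems obtain G' where "\<And>f. kleene_rel d (T1 f # T3 \<Psi> # \<Phi>) (G' f)" "\<Psi> G' = Some m'"
    by (cases rule: kleene_rel.cases) (auto simp del: list_encode.simps simp: list_encode_eq)
  moreover from this have "G = G'" by (intro ext S8_3.IH) blast
  ultimately show ?case using S8_3.hyps by simp
next
  case (S9 d \<Phi> m \<Psi>)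
  from S9.prems show ?case
    by (cases rule: kleene_rel.cases)
      (auto simp del: list_encode.simps simp: list_encode_eq dest!: S9.IH)
qed

definition kleene :: "nat \<Rightarrow> obj list \<Rightarrow> nat option" where
  "kleene e \<Phi> = (if \<exists>m. kleene_rel e \<Phi> m then Some (THE m. kleene_rel e \<Phi> m) else None)"

lemma kleene_eq_Some_iff: "kleene e \<Phi> = Some m \<longleftrightarrow> kleene_rel e \<Phi> m"
  unfolding kleene_def by (auto intro: theI kleene_rel_unique dest: kleene_rel_unique)

definition exists2 :: type2 where
  "exists2 f = (if \<exists>n. f n = 0 then 0 else 1)"

definition total2 :: "type2 \<Rightarrow> obj" where
  "total2 F = T2 (\<lambda>f. Some (F f))"

definition codes :: "type1 \<Rightarrow> real \<Rightarrow> bool" where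
  "codes \<alpha> x \<longleftrightarrow>
     (let q = (\<lambda>n. of_rat (nat_to_rat_surj (\<alpha> n)) :: real)
      in (\<forall>n i. \<bar>q n - q (n + i)\<bar> < 1 / 2 ^ n) \<and> q \<longlonglongrightarrow> x)"

text \<open>
  Nothing is required of \<open>F\<close> on sequences that do not code an element of the domain.  Since
  the same \<open>x\<close> has many codes, extensionality is part of the definition.
\<close>

definition codes_fun :: "(type1 \<Rightarrow> type1) \<Rightarrow> (real \<Rightarrow> real) \<Rightarrow> bool" where
  "codes_fun F f \<longleftrightarrow> (\<forall>\<alpha>. \<forall>x\<in>{0..1}. codes \<alpha> x \<longrightarrow> codes (F \<alpha>) (f x))"

text \<open>The same for a map on codes that is computed argumentwise and may be undefined off the codes.\<close>

definition codes_pfun :: "(type1 \<Rightarrow> nat \<Rightarrow> nat option) \<Rightarrow> (real \<Rightarrow> real) \<Rightarrow> bool" where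
  "codes_pfun P f \<longleftrightarrow>
     (\<forall>\<alpha>. \<forall>x\<in>{0..1}. codes \<alpha> x \<longrightarrow> (\<exists>\<beta>. (\<forall>k. P \<alpha> k = Some (\<beta> k)) \<and> codes \<beta> (f x)))"

definition codes_set :: "type2 \<Rightarrow> real set \<Rightarrow> bool" where
  "codes_set S X \<longleftrightarrow> (\<forall>\<alpha> x. codes \<alpha> x \<longrightarrow> S \<alpha> = (if x \<in> X then 1 else 0))"

definition baire1 :: "(real \<Rightarrow> real) \<Rightarrow> bool" where
  "baire1 f \<longleftrightarrow>
     (\<exists>g. (\<forall>n::nat. continuous_on {0..1} (g n)) \<and> (\<forall>x\<in>{0..1}. (\<lambda>n. g n x) \<longlonglongrightarrow> f x))"

text \<open>The oscillation of an unbounded function may be infinite.\<close>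

definition osc_on :: "(real \<Rightarrow> real) \<Rightarrow> real set \<Rightarrow> ereal" where
  "osc_on f A = (SUP x\<in>A. ereal (f x)) - (INF x\<in>A. ereal (f x))"

definition osc :: "(real \<Rightarrow> real) \<Rightarrow> real \<Rightarrow> ereal" where
  "osc f x = lim (\<lambda>k::nat. osc_on f (ball x (1 / 2 ^ k) \<inter> {0..1}))"

definition osc_ge :: "(real \<Rightarrow> real) \<Rightarrow> nat \<Rightarrow> real set" where
  "osc_ge f n = {x \<in> {0..1}. osc f x \<ge> ereal (1 / 2 ^ n)}"

definition R2 :: "(real \<Rightarrow> real) \<Rightarrow> real set \<Rightarrow> bool" where
  "R2 Y U \<longleftrightarrow>
     Y \<in> {0..1} \<rightarrow> {0..1} \<and> U = {x \<in> {0..1}. Y x > 0} \<and>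
     (\<forall>x\<in>{0..1}. Y x > 0 \<longrightarrow> {x - Y x <..< x + Y x} \<inter> {0..1} \<subseteq> U)"

definition R3 :: "(real \<Rightarrow> real) \<Rightarrow> real set \<Rightarrow> bool" where
  "R3 Y U \<longleftrightarrow> (\<forall>x\<in>{0..1}. Y x = (if U = {0..1} then 1 else infdist x ({0..1} - U)))"

text \<open>
  The functionals below have their natural (curried) argument types; outputs of higher type are
  given argumentwise.  To be used as arguments of Kleene's schemes they are contracted to pure type,
  where \<open>case_nat k \<alpha>\<close> is the sequence \<open>\<alpha>\<close> with \<open>k\<close> put in front.  A type 2 object \<open>G\<close> is read as
  a tuple whose \<open>j\<close>-th component is \<open>\<lambda>\<alpha>. G (case_nat j \<alpha>)\<close>.
\<close>

definition fun_comp :: "nat \<Rightarrow> type2 \<Rightarrow> type1 \<Rightarrow> type1" where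
  "fun_comp j G \<alpha> k = G (case_nat j (case_nat k \<alpha>))"

definition seq_comp :: "nat \<Rightarrow> type2 \<Rightarrow> type1" where
  "seq_comp j G k = G (case_nat j (case_nat k (\<lambda>_. 0)))"

definition nat_comp :: "nat \<Rightarrow> type2 \<Rightarrow> nat" where
  "nat_comp j G = G (case_nat j (\<lambda>_. 0))"

type_synonym osc_functional =
  "(type1 \<Rightarrow> type1) \<Rightarrow> (type1 \<Rightarrow> type1) \<Rightarrow> nat \<Rightarrow> type1 \<Rightarrow> nat \<Rightarrow> nat option"

definition osc_functional_obj :: "osc_functional \<Rightarrow> obj" where
  "osc_functional_obj \<Theta> =
     T3 (\<lambda>G. \<Theta> (fun_comp 0 G) (fun_comp 1 G) (nat_comp 2 G) (seq_comp 3 G) (nat_comp 4 G))"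

text \<open>
  The hypothesis on \<open>G\<close> says that the oscillation function is real-valued and coded by \<open>G\<close>.  The
  output may depend on the codes \<open>F\<close> and \<open>G\<close>, and nothing is required for other inputs.
\<close>

definition is_osc_functional :: "osc_functional \<Rightarrow> bool" where
  "is_osc_functional \<Theta> \<longleftrightarrow>
     (\<forall>f w F G n. baire1 f \<and> (\<forall>x\<in>{0..1}. osc f x = ereal (w x)) \<and> codes_fun F f \<and> codes_fun G w \<longrightarrow>
        (\<exists>Y. R2 Y ({0..1} - osc_ge f n) \<and> codes_pfun (\<Theta> F G n) Y))"

type_synonym conv_functional = "(type1 \<Rightarrow> type1) \<Rightarrow> type1 \<Rightarrow> nat \<Rightarrow> nat option"

definition conv_functional_obj :: "conv_functional \<Rightarrow> obj" where
  "conv_functional_obj \<Delta> = T3 (\<lambda>G. \<Delta> (fun_comp 0 G) (seq_comp 1 G) (nat_comp 2 G))"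

definition is_R2_to_R3 :: "conv_functional \<Rightarrow> bool" where
  "is_R2_to_R3 \<Delta> \<longleftrightarrow>
     (\<forall>U Y F. openin (top_of_set {0..1}) U \<and> R2 Y U \<and> codes_fun F Y \<longrightarrow>
        (\<exists>Z. R3 Z U \<and> codes_pfun (\<Delta> F) Z))"

definition seq_obj :: "(nat \<Rightarrow> type2) \<Rightarrow> obj" where
  "seq_obj S = total2 (\<lambda>\<beta>. S (\<beta> 0) (\<lambda>i. \<beta> (Suc i)))"

definition baire_realiser :: "((nat \<Rightarrow> type2) \<Rightarrow> nat \<Rightarrow> nat option) \<Rightarrow> bool" where
  "baire_realiser \<xi> \<longleftrightarrow>
     (\<forall>U S. (\<forall>n. open (U n) \<and> closure (U n) = UNIV \<and> codes_set (S n) (U n)) \<longrightarrow>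
        (\<exists>\<beta> x. (\<forall>k. \<xi> S k = Some (\<beta> k)) \<and> codes \<beta> x \<and> x \<in> (\<Inter>n. U n)))"

text \<open>
  A finite sequence of reals is coded by \<open>\<beta>\<close> if \<open>\<beta> 0\<close> is its length and the \<open>i\<close>-th entry is coded
  by \<open>\<lambda>k. \<beta> (Suc (prod_encode (i, k)))\<close>.
\<close>

definition codes_list :: "type1 \<Rightarrow> real list \<Rightarrow> bool" where
  "codes_list \<beta> xs \<longleftrightarrow>
     \<beta> 0 = length xs \<and> (\<forall>i < length xs. codes (\<lambda>k. \<beta> (Suc (prod_encode (i, k)))) (xs ! i))"

definition finiteness_realiser :: "(type2 \<Rightarrow> nat \<Rightarrow> nat option) \<Rightarrow> bool" where
  "finiteness_realiser \<Omega> \<longleftrightarrow>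
     (\<forall>X S. finite X \<and> codes_set S X \<longrightarrow>
        (\<exists>\<beta> xs. (\<forall>k. \<Omega> S k = Some (\<beta> k)) \<and> codes_list \<beta> xs \<and> X \<subseteq> set xs))"

end

theory Submission
  imports Defs
begin

text \<open>
  For a sequence \<open>U\<close> of dense open sets let \<open>f x\<close> be \<open>1 / 2 ^ n\<close> for the least \<open>n\<close> with
  \<open>x \<notin> U n\<close>, and 0 if there is none.  Then \<open>f\<close> is upper
  semicontinuous, hence Baire 1, and since it is arbitrarily small on a dense set it is its own
  oscillation function.  So \<open>\<exists>\<^sup>2\<close> computes both inputs of \<open>\<Theta>\<close>, and \<open>D\<^sub>n\<close> is the complement of
  \<open>U 0 \<inter> \<dots> \<inter> U n\<close>.

  (1) With the (R.2)-representations returned by \<open>\<Theta>\<close> the usual proof of the Baire category theorem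
  becomes effective: given a rational interval, search for a rational centre inside it at which the
  \<open>n\<close>-th representation is positive, and shrink to a smaller interval that it certifies.

  (2) For finite \<open>X\<close> and rational \<open>q\<close>, take all \<open>U n\<close> to be the complement of \<open>X - q\<close>.  Then \<open>\<Delta>\<close>
  yields the distance \<open>Z\<close> to \<open>X - q\<close> on the unit interval, and \<open>q + Z 0\<close> is the least element of
  \<open>X\<close> in \<open>{q..q + 1}\<close>, if there is one.  As \<open>q\<close> varies, these reals form a sequence that contains
  every element of \<open>X\<close>, and \<open>\<exists>\<^sup>2\<close> finds an initial segment that does so.
\<close>

declare list_encode.simps [simp del]

section \<open>Closure properties of Kleene computability\<close>

text \<open>
  A context relates an environment \<open>x\<close> to the argument lists on which it is presented to a
  computation; \<open>num_ctx\<close> and \<open>fun_ctx\<close> bind a new variable of type 0 and 1 in front.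
\<close>

type_synonym 'x ctx = "'x \<Rightarrow> obj list \<Rightarrow> bool"

definition num_ctx :: "'x ctx \<Rightarrow> (nat \<times> 'x) ctx" where
  "num_ctx E z \<Phi> \<longleftrightarrow> (\<exists>\<Phi>'. \<Phi> = T0 (fst z) # \<Phi>' \<and> E (snd z) \<Phi>')"

definition fun_ctx :: "'x ctx \<Rightarrow> (type1 \<times> 'x) ctx" where
  "fun_ctx E z \<Phi> \<longleftrightarrow> (\<exists>\<Phi>'. \<Phi> = T1 (fst z) # \<Phi>' \<and> E (snd z) \<Phi>')"

text \<open>Carries a precondition on the environment: a branch taken only under a test may rely on
  it, as a partial functional must when it is not defined elsewhere.\<close>

definition sub_ctx :: "'x ctx \<Rightarrow> ('x \<Rightarrow> bool) \<Rightarrow> 'x ctx" where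
  "sub_ctx E P x \<Phi> \<longleftrightarrow> E x \<Phi> \<and> P x"

definition ctx_length :: "'x ctx \<Rightarrow> nat \<Rightarrow> bool" where
  "ctx_length E L \<longleftrightarrow> (\<forall>x \<Phi>. E x \<Phi> \<longrightarrow> length \<Phi> = L)"

text \<open>One position serves all argument lists of the context, so that a single index can
  address the functional.\<close>

definition has2 :: "'x ctx \<Rightarrow> ('x \<Rightarrow> type1 \<Rightarrow> nat option) \<Rightarrow> bool" where
  "has2 E \<Psi> \<longleftrightarrow> (\<exists>i. \<forall>x \<Phi>. E x \<Phi> \<longrightarrow> i < length \<Phi> \<and> \<Phi> ! i = T2 (\<Psi> x))"

definition has3 :: "'x ctx \<Rightarrow> ('x \<Rightarrow> type2 \<Rightarrow> nat option) \<Rightarrow> bool" where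
  "has3 E \<Psi> \<longleftrightarrow> (\<exists>i. \<forall>x \<Phi>. E x \<Phi> \<longrightarrow> i < length \<Phi> \<and> \<Phi> ! i = T3 (\<Psi> x))"

text \<open>Indices for S6 and S9 have the length of lists built in, hence the common length. The
  presence of \<open>exists2\<close> makes number quantifiers decidable in every such
  context.\<close>

definition good_ctx :: "'x ctx \<Rightarrow> bool" where
  "good_ctx E \<longleftrightarrow> (\<exists>L. ctx_length E L) \<and> has2 E (\<lambda>x f. Some (exists2 f))"

text \<open>The index is chosen before the environment, which is the uniformity in the given
  functionals. Only environments with an argument list in the context matter.\<close>

definition computes :: "'x ctx \<Rightarrow> ('x \<Rightarrow> nat) \<Rightarrow> bool" where
  "computes E g \<longleftrightarrow> (\<exists>e. \<forall>x \<Phi>. E x \<Phi> \<longrightarrow> kleene_rel e \<Phi> (g x))"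

definition computes1 :: "'x ctx \<Rightarrow> ('x \<Rightarrow> type1) \<Rightarrow> bool" where
  "computes1 E \<alpha> \<longleftrightarrow> computes (num_ctx E) (\<lambda>z. \<alpha> (snd z) (fst z))"

definition dec :: "'x ctx \<Rightarrow> ('x \<Rightarrow> bool) \<Rightarrow> bool" where
  "dec E P \<longleftrightarrow> computes E (\<lambda>x. of_bool (P x))"

text \<open>S6 moves the selected arguments to the front, S2 and S4 put the index \<open>e\<close>
  before them, and S9 runs \<open>e\<close> on the first \<open>length ps\<close> arguments,
  discarding the others.\<close>

lemma kleene_select:
  assumes "distinct ps" "set ps \<subseteq> {..<L}"
  shows "\<exists>e'. \<forall>\<Phi> m. length \<Phi> = L \<longrightarrow> kleene_rel e (map (\<lambda>i. \<Phi> ! i) ps) m \<longrightarrow> kleene_rel e' \<Phi> m"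
proof -
  define rest where "rest = filter (\<lambda>i. i \<notin> set ps) [0..<L]"
  define e' where "e' = list_encode [6, list_encode (ps @ rest),
    list_encode [4, list_encode [9, length ps], list_encode [2, e]]]"
  have "kleene_rel e' \<Phi> m" if "length \<Phi> = L" "kleene_rel e (map (\<lambda>i. \<Phi> ! i) ps) m" for \<Phi> m
    unfolding e'_def
  proof (rule S6)
    show "distinct (ps @ rest)" using assms by (auto simp: rest_def)
    show "set (ps @ rest) = {..<length \<Phi>}" using assms that by (auto simp: rest_def)
    have "kleene_rel (list_encode [9, length (map (\<lambda>i. \<Phi> ! i) ps)])
        (T0 e # map (\<lambda>i. \<Phi> ! i) ps @ map (\<lambda>i. \<Phi> ! i) rest) m"
      by (rule S9) (rule that)
    then show "kleene_rel (list_encode [4, list_encode [9, length ps], list_encode [2, e]])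
        (map (\<lambda>i. \<Phi> ! i) (ps @ rest)) m"
      by (intro S4[OF S2]) simp
  qed
  then show ?thesis by blast
qed

lemma kleene_drop: "\<exists>e'. \<forall>a \<Phi> m. length \<Phi> = L \<longrightarrow> kleene_rel e \<Phi> m \<longrightarrow> kleene_rel e' (a # \<Phi>) m"
proof -
  have "\<exists>e'. \<forall>\<Phi> m. length \<Phi> = Suc L \<longrightarrow> kleene_rel e (map (\<lambda>i. \<Phi> ! i) [1..<Suc L]) m \<longrightarrow> kleene_rel e' \<Phi> m"
    by (rule kleene_select) auto
  then obtain e' where e': "\<And>\<Phi> m. length \<Phi> = Suc L \<Longrightarrow> kleene_rel e (map (\<lambda>i. \<Phi> ! i) [1..<Suc L]) m \<Longrightarrow> kleene_rel e' \<Phi> m"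
    by blast
  have "map (\<lambda>i. (a # \<Phi>) ! i) [1..<Suc L] = \<Phi>" if "length \<Phi> = L" for a and \<Phi> :: "obj list"
    using that by (intro nth_equalityI) (auto simp del: upt_Suc)
  with e' show ?thesis by (metis length_Cons)
qed

section \<open>Uniform indices over a context and weakening of contexts\<close>

lemma computesE:
  assumes "computes E g"
  obtains e where "\<And>x \<Phi>. E x \<Phi> \<Longrightarrow> kleene_rel e \<Phi> (g x)"
  using assms unfolding computes_def by blast

lemma computes_numE:
  assumes "computes (num_ctx E) g"
  obtains e where "\<And>n x \<Phi>. E x \<Phi> \<Longrightarrow> kleene_rel e (T0 n # \<Phi>) (g (n, x))"
proof -
  obtain e where e: "\<And>z \<Phi>. num_ctx E z \<Phi> \<Longrightarrow> kleene_rel e \<Phi> (g z)"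
    using computesE[OF assms] by blast
  have "kleene_rel e (T0 n # \<Phi>) (g (n, x))" if "E x \<Phi>" for n x \<Phi>
    using that by (intro e) (simp add: num_ctx_def)
  then show ?thesis by (rule that)
qed

lemma computes_funE:
  assumes "computes (fun_ctx E) g"
  obtains e where "\<And>f x \<Phi>. E x \<Phi> \<Longrightarrow> kleene_rel e (T1 f # \<Phi>) (g (f, x))"
proof -
  obtain e where e: "\<And>z \<Phi>. fun_ctx E z \<Phi> \<Longrightarrow> kleene_rel e \<Phi> (g z)"
    using computesE[OF assms] by blast
  have "kleene_rel e (T1 f # \<Phi>) (g (f, x))" if "E x \<Phi>" for f x \<Phi>
    using that by (intro e) (simp add: fun_ctx_def)
  then show ?thesis by (rule that)
qed

lemma good_ctxE:
  assumes "good_ctx E"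
  obtains L where "\<And>x \<Phi>. E x \<Phi> \<Longrightarrow> length \<Phi> = L"
  using assms unfolding good_ctx_def ctx_length_def by blast

lemma computes_weaken_num: "good_ctx E \<Longrightarrow> computes E g \<Longrightarrow> computes (num_ctx E) (\<lambda>z. g (snd z))"
  by (auto simp: computes_def good_ctx_def ctx_length_def num_ctx_def) (metis kleene_drop)

lemma computes_weaken_fun: "good_ctx E \<Longrightarrow> computes E g \<Longrightarrow> computes (fun_ctx E) (\<lambda>z. g (snd z))"
  by (auto simp: computes_def good_ctx_def ctx_length_def fun_ctx_def) (metis kleene_drop)

lemma computes_sub: "computes E g \<Longrightarrow> computes (sub_ctx E P) g"
  unfolding computes_def sub_ctx_def by blast

lemma has2_num: "has2 E \<Psi> \<Longrightarrow> has2 (num_ctx E) (\<lambda>z. \<Psi> (snd z))"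
  unfolding has2_def num_ctx_def by (metis Suc_less_eq length_Cons nth_Cons_Suc)

lemma has2_fun: "has2 E \<Psi> \<Longrightarrow> has2 (fun_ctx E) (\<lambda>z. \<Psi> (snd z))"
  unfolding has2_def fun_ctx_def by (metis Suc_less_eq length_Cons nth_Cons_Suc)

lemma has2_sub: "has2 E \<Psi> \<Longrightarrow> has2 (sub_ctx E P) \<Psi>"
  unfolding has2_def sub_ctx_def by blast

lemma has3_num: "has3 E \<Psi> \<Longrightarrow> has3 (num_ctx E) (\<lambda>z. \<Psi> (snd z))"
  unfolding has3_def num_ctx_def by (metis Suc_less_eq length_Cons nth_Cons_Suc)

lemma has3_fun: "has3 E \<Psi> \<Longrightarrow> has3 (fun_ctx E) (\<lambda>z. \<Psi> (snd z))"
  unfolding has3_def fun_ctx_def by (metis Suc_less_eq length_Cons nth_Cons_Suc)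

lemma has3_sub: "has3 E \<Psi> \<Longrightarrow> has3 (sub_ctx E P) \<Psi>"
  unfolding has3_def sub_ctx_def by blast

lemma good_num [intro, simp]: "good_ctx E \<Longrightarrow> good_ctx (num_ctx E)"
  using has2_num[of E "\<lambda>x f. Some (exists2 f)"]
  by (force simp: good_ctx_def ctx_length_def num_ctx_def)

lemma good_fun [intro, simp]: "good_ctx E \<Longrightarrow> good_ctx (fun_ctx E)"
  using has2_fun[of E "\<lambda>x f. Some (exists2 f)"]
  by (force simp: good_ctx_def ctx_length_def fun_ctx_def)

lemma good_sub [intro, simp]: "good_ctx E \<Longrightarrow> good_ctx (sub_ctx E P)"
  using has2_sub[of E "\<lambda>x f. Some (exists2 f)"]
  by (force simp: good_ctx_def ctx_length_def sub_ctx_def)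

section \<open>The schemes on numbers and sequences, recursion and search\<close>

lemma computes_const: "computes E (\<lambda>x. c)"
  unfolding computes_def using S2 by blast

lemma computes_num_var: "computes (num_ctx E) (\<lambda>z. fst z)"
  unfolding computes_def num_ctx_def using S3 by blast

lemma computes_subst: "computes E a \<Longrightarrow> computes (num_ctx E) (\<lambda>z. g (fst z) (snd z)) \<Longrightarrow> computes E (\<lambda>x. g (a x) x)"
proof -
  assume a: "computes E a" and g: "computes (num_ctx E) (\<lambda>z. g (fst z) (snd z))"
  obtain e1 where e1: "\<And>x \<Phi>. E x \<Phi> \<Longrightarrow> kleene_rel e1 \<Phi> (a x)"
    using computesE[OF a] by blast
  obtain e2 where e2: "\<And>n x \<Phi>. E x \<Phi> \<Longrightarrow> kleene_rel e2 (T0 n # \<Phi>) (g n x)"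
    using computes_numE[OF g, unfolded fst_conv snd_conv] by blast
  have "kleene_rel (list_encode [4, e2, e1]) \<Phi> (g (a x) x)" if "E x \<Phi>" for x \<Phi>
    using e1[OF that] e2[OF that] by (rule S4)
  then show ?thesis unfolding computes_def by blast
qed

lemma computes_Suc: "computes E a \<Longrightarrow> computes E (\<lambda>x. Suc (a x))"
proof (rule computes_subst[where g = "\<lambda>n x. Suc n"])
  show "computes (num_ctx E) (\<lambda>z. Suc (fst z))"
    unfolding computes_def num_ctx_def using S1 by blast
qed

lemma computes1_app: "computes1 E \<alpha> \<Longrightarrow> computes E a \<Longrightarrow> computes E (\<lambda>x. \<alpha> x (a x))"
  unfolding computes1_def by (rule computes_subst)

lemma computes1_fun_var:
  assumes "good_ctx E"
  shows "computes1 (fun_ctx E) (\<lambda>z. fst z)"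
proof -
  from assms obtain L where L: "\<And>x \<Phi>. E x \<Phi> \<Longrightarrow> length \<Phi> = L"
    by (auto simp: good_ctx_def ctx_length_def)
  \<comment> \<open>S7 expects the function before the number, whereas \<open>num_ctx\<close> has
    put the number first; the positions \<open>[1, 0]\<close> swap them.\<close>
  have "\<exists>e'. \<forall>\<Phi> m. length \<Phi> = Suc (Suc L) \<longrightarrow> kleene_rel (list_encode [7]) (map (\<lambda>i. \<Phi> ! i) [1, 0]) m \<longrightarrow> kleene_rel e' \<Phi> m"
    by (rule kleene_select) auto
  then obtain e' where e': "\<And>\<Phi> m. length \<Phi> = Suc (Suc L) \<Longrightarrow> kleene_rel (list_encode [7]) (map (\<lambda>i. \<Phi> ! i) [1, 0]) m \<Longrightarrow> kleene_rel e' \<Phi> m"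
    by blast
  show ?thesis
    unfolding computes1_def computes_def num_ctx_def fun_ctx_def
    by (rule exI[of _ e']) (auto intro!: e' S7 dest: L)
qed

text \<open>A sequence is evaluated at a number placed in front of the list, so weakening its
  context inserts the new argument in second place.\<close>

lemma kleene_drop_second:
  "\<exists>e'. \<forall>a b \<Phi> m. length \<Phi> = L \<longrightarrow> kleene_rel e (a # \<Phi>) m \<longrightarrow> kleene_rel e' (a # b # \<Phi>) m"
proof -
  let ?ps = "0 # [2..<Suc (Suc L)]"
  have "\<exists>e'. \<forall>\<Phi> m. length \<Phi> = Suc (Suc L) \<longrightarrow> kleene_rel e (map (\<lambda>i. \<Phi> ! i) ?ps) m \<longrightarrow> kleene_rel e' \<Phi> m"
    by (rule kleene_select) auto
  then obtain e' where e': "\<And>\<Phi> m. length \<Phi> = Suc (Suc L) \<Longrightarrow> kleene_rel e (map (\<lambda>i. \<Phi> ! i) ?ps) m \<Longrightarrow> kleene_rel e' \<Phi> m"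
    by blast
  have "map (\<lambda>i. (a # b # \<Phi>) ! i) ?ps = a # \<Phi>" if "length \<Phi> = L" for a b and \<Phi> :: "obj list"
    using that by (intro nth_equalityI) (auto simp del: upt_Suc simp: nth_Cons' nth_append)
  with e' show ?thesis by (metis length_Cons)
qed

lemma computes1_weaken_num:
  assumes "good_ctx E" "computes1 E \<alpha>"
  shows "computes1 (num_ctx E) (\<lambda>z. \<alpha> (snd z))"
proof -
  obtain L where L: "\<And>x \<Phi>. E x \<Phi> \<Longrightarrow> length \<Phi> = L"
    using good_ctxE[OF assms(1)] by blast
  obtain e where e: "\<And>n x \<Phi>. E x \<Phi> \<Longrightarrow> kleene_rel e (T0 n # \<Phi>) (\<alpha> x n)"
    using computes_numE[OF assms(2)[unfolded computes1_def], unfolded fst_conv snd_conv] by blast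
  obtain e' where "\<And>a b \<Phi> m. length \<Phi> = L \<Longrightarrow> kleene_rel e (a # \<Phi>) m \<Longrightarrow> kleene_rel e' (a # b # \<Phi>) m"
    using kleene_drop_second by metis
  with L e show ?thesis
    unfolding computes1_def computes_def num_ctx_def by (intro exI[of _ e']) auto
qed

lemma computes1_weaken_fun:
  assumes "good_ctx E" "computes1 E \<alpha>"
  shows "computes1 (fun_ctx E) (\<lambda>z. \<alpha> (snd z))"
proof -
  obtain L where L: "\<And>x \<Phi>. E x \<Phi> \<Longrightarrow> length \<Phi> = L"
    using good_ctxE[OF assms(1)] by blast
  obtain e where e: "\<And>n x \<Phi>. E x \<Phi> \<Longrightarrow> kleene_rel e (T0 n # \<Phi>) (\<alpha> x n)"
    using computes_numE[OF assms(2)[unfolded computes1_def], unfolded fst_conv snd_conv] by blast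
  obtain e' where "\<And>a b \<Phi> m. length \<Phi> = L \<Longrightarrow> kleene_rel e (a # \<Phi>) m \<Longrightarrow> kleene_rel e' (a # b # \<Phi>) m"
    using kleene_drop_second by metis
  with L e show ?thesis
    unfolding computes1_def computes_def num_ctx_def fun_ctx_def by (intro exI[of _ e']) auto
qed

lemma computes1_sub: "computes1 E \<alpha> \<Longrightarrow> computes1 (sub_ctx E P) \<alpha>"
  unfolding computes1_def computes_def sub_ctx_def num_ctx_def by blast

lemma computes_rec:
  assumes "computes E c" "computes E g"
    and "computes (num_ctx (num_ctx E)) (\<lambda>z. h (fst z) (fst (snd z)) (snd (snd z)))"
  shows "computes E (\<lambda>x. rec_nat (g x) (\<lambda>n r. h n r x) (c x))"
  using assms(1)
proof (rule computes_subst)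
  obtain e1 where e1: "\<And>x \<Phi>. E x \<Phi> \<Longrightarrow> kleene_rel e1 \<Phi> (g x)"
    using computesE[OF assms(2)] by blast
  obtain e2 where e2': "\<And>n z \<Phi>. num_ctx E z \<Phi> \<Longrightarrow> kleene_rel e2 (T0 n # \<Phi>) (h n (fst z) (snd z))"
    using computes_numE[OF assms(3), unfolded fst_conv snd_conv] by blast
  have e2: "kleene_rel e2 (T0 n # T0 r # \<Phi>) (h n r x)" if "E x \<Phi>" for n r x \<Phi>
    using e2'[of "(r, x)" "T0 r # \<Phi>"] that by (simp add: num_ctx_def)
  have "kleene_rel (list_encode [5, e1, e2]) (T0 n # \<Phi>) (rec_nat (g x) (\<lambda>n r. h n r x) n)"
    if "E x \<Phi>" for n x \<Phi>
    by (induction n) (auto intro: S5_zero S5_Suc e1 e2 that)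
  then show "computes (num_ctx E) (\<lambda>z. rec_nat (g (snd z)) (\<lambda>n r. h n r (snd z)) (fst z))"
    unfolding computes_def num_ctx_def by fastforce
qed

text \<open>
  S5 evaluates the base case before the step, so only the branch of the positive case is lazy.
\<close>

lemma computes_if_lazy:
  assumes "good_ctx E" "dec E P" "computes (sub_ctx E P) a" "computes E b"
  shows "computes E (\<lambda>x. if P x then a x else b x)"
proof -
  obtain L where L: "\<And>x \<Phi>. E x \<Phi> \<Longrightarrow> length \<Phi> = L"
    using assms(1) by (auto simp: good_ctx_def ctx_length_def)
  obtain p d1 d2 where p: "\<And>x \<Phi>. E x \<Phi> \<Longrightarrow> kleene_rel p \<Phi> (of_bool (P x))"
    and d1: "\<And>x \<Phi>. E x \<Phi> \<Longrightarrow> P x \<Longrightarrow> kleene_rel d1 \<Phi> (a x)"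
    and d2: "\<And>x \<Phi>. E x \<Phi> \<Longrightarrow> kleene_rel d2 \<Phi> (b x)"
    using assms(2-4) unfolding dec_def computes_def sub_ctx_def by blast
  obtain d where d: "\<And>a \<Phi> m. length \<Phi> = L \<Longrightarrow> kleene_rel d1 \<Phi> m \<Longrightarrow> kleene_rel d (a # \<Phi>) m"
    using kleene_drop by metis
  obtain d' where d': "\<And>a \<Phi> m. length \<Phi> = Suc L \<Longrightarrow> kleene_rel d \<Phi> m \<Longrightarrow> kleene_rel d' (a # \<Phi>) m"
    using kleene_drop by metis
  have "kleene_rel (list_encode [4, list_encode [5, d2, d'], p]) \<Phi> (if P x then a x else b x)"
    if E: "E x \<Phi>" for x \<Phi>
  proof (rule S4[OF p[OF E]])
    have *: "kleene_rel (list_encode [5, d2, d']) (T0 0 # \<Phi>) (b x)"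
      by (intro S5_zero d2 E)
    show "kleene_rel (list_encode [5, d2, d']) (T0 (of_bool (P x)) # \<Phi>) (if P x then a x else b x)"
    proof (cases "P x")
      case True
      then have "kleene_rel d' (T0 0 # T0 (b x) # \<Phi>) (a x)"
        by (intro d' d d1 E) (simp_all add: L[OF E])
      with S5_Suc[OF *] True show ?thesis by simp
    qed (use * in simp)
  qed
  then show ?thesis unfolding computes_def by blast
qed

text \<open>
  Unbounded search: the index receives itself as its first argument and restarts by S9 at the next
  candidate.
\<close>

lemma computes_Least:
  assumes "good_ctx E" and P: "dec (num_ctx E) (\<lambda>z. P (fst z) (snd z))"
    and ex: "\<And>x \<Phi>. E x \<Phi> \<Longrightarrow> \<exists>n. P n x"
  shows "computes E (\<lambda>x. LEAST n. P n x)"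
proof -
  obtain L where L: "\<And>x \<Phi>. E x \<Phi> \<Longrightarrow> length \<Phi> = L"
    using assms(1) by (auto simp: good_ctx_def ctx_length_def)
  have "(\<lambda>z. of_bool (\<not> P (fst z) (snd z))) = (\<lambda>z. if P (fst z) (snd z) then 0 else 1 :: nat)"
    by auto
  then have notP: "computes (num_ctx E) (\<lambda>z. of_bool (\<not> P (fst z) (snd z)))"
    using computes_if_lazy[OF good_num[OF assms(1)] P computes_const computes_const] by metis
  obtain p where p: "\<And>n x \<Phi>. E x \<Phi> \<Longrightarrow> kleene_rel p (T0 n # \<Phi>) (of_bool (\<not> P n x))"
    using computes_numE[OF notP, unfolded fst_conv snd_conv] by blast
  obtain p' where p': "\<And>a \<Phi> m. length \<Phi> = Suc L \<Longrightarrow> kleene_rel p \<Phi> m \<Longrightarrow> kleene_rel p' (a # \<Phi>) m"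
    using kleene_drop by metis
  obtain v where v: "\<And>a n \<Phi>. length \<Phi> = L \<Longrightarrow> kleene_rel v (a # T0 n # \<Phi>) n"
  proof -
    obtain v where "\<And>a \<Phi> m. length \<Phi> = Suc L \<Longrightarrow> kleene_rel (list_encode [3]) \<Phi> m \<Longrightarrow> kleene_rel v (a # \<Phi>) m"
      using kleene_drop by metis
    then have "kleene_rel v (a # T0 n # \<Phi>) n" if "length \<Phi> = L" for a n \<Phi>
      using that S3 by simp
    then show ?thesis using that by blast
  qed
  \<comment> \<open>The restart: \<open>i\<close> reads \<open>n\<close> and yields its successor,
    \<open>j\<close> reads the index \<open>y\<close>, and \<open>r\<close> arranges both so that S9
    runs \<open>y\<close> on \<open>y\<close>, \<open>Suc n\<close> and the original arguments. The
    entries \<open>a\<close> and \<open>b\<close> are the counter and the value passed on by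
    S5.\<close>
  obtain s where s: "kleene_rel s (T0 a # T0 b # T0 y # T0 n # \<Phi>) m"
    if "length \<Phi> = L" "kleene_rel y (T0 y # T0 (Suc n) # \<Phi>) m" for a b y n \<Phi> m
  proof -
    obtain i where i: "\<And>\<Phi> m. length \<Phi> = L + 4 \<Longrightarrow>
        kleene_rel (list_encode [1]) (map (\<lambda>i. \<Phi> ! i) [3]) m \<Longrightarrow> kleene_rel i \<Phi> m"
      using kleene_select[of "[3]" "L + 4" "list_encode [1]"] by force
    obtain j where j: "\<And>\<Phi> m. length \<Phi> = L + 5 \<Longrightarrow>
        kleene_rel (list_encode [3]) (map (\<lambda>i. \<Phi> ! i) [3]) m \<Longrightarrow> kleene_rel j \<Phi> m"
      using kleene_select[of "[3]" "L + 5" "list_encode [3]"] by force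
    let ?ps = "[0, 4, 1] @ [6..<L + 6]"
    have "\<exists>e'. \<forall>\<Phi> m. length \<Phi> = L + 6 \<longrightarrow>
        kleene_rel (list_encode [9, L + 2]) (map (\<lambda>i. \<Phi> ! i) ?ps) m \<longrightarrow> kleene_rel e' \<Phi> m"
      by (rule kleene_select) auto
    then obtain r where r: "\<And>\<Phi> m. length \<Phi> = L + 6 \<Longrightarrow>
        kleene_rel (list_encode [9, L + 2]) (map (\<lambda>i. \<Phi> ! i) ?ps) m \<Longrightarrow> kleene_rel r \<Phi> m"
      by blast
    have "kleene_rel (list_encode [4, list_encode [4, r, j], i]) (T0 a # T0 b # T0 y # T0 n # \<Phi>) m"
      if len: "length \<Phi> = L" and y: "kleene_rel y (T0 y # T0 (Suc n) # \<Phi>) m" for a b y n \<Phi> m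
    proof (intro S4[of i _ "Suc n"] S4[of j _ y])
      let ?\<Psi> = "T0 y # T0 (Suc n) # T0 a # T0 b # T0 y # T0 n # \<Phi>"
      show "kleene_rel i (T0 a # T0 b # T0 y # T0 n # \<Phi>) (Suc n)"
        using len S1[of n "[]"] by (intro i) auto
      show "kleene_rel j (T0 (Suc n) # T0 a # T0 b # T0 y # T0 n # \<Phi>) y"
        using len S3[of y "[]"] by (intro j) auto
      have "map (\<lambda>i. ?\<Psi> ! i) ?ps = T0 y # (T0 y # T0 (Suc n) # \<Phi>) @ []"
        using len by (intro nth_equalityI) (auto simp: nth_Cons' nth_append)
      then have "kleene_rel (list_encode [9, L + 2]) (map (\<lambda>i. ?\<Psi> ! i) ?ps) m"
        using S9[of y "T0 y # T0 (Suc n) # \<Phi>" m "[]"] y len by simp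
      then show "kleene_rel r ?\<Psi> m" using len by (intro r) auto
    qed
    then show ?thesis by (rule that)
  qed
  \<comment> \<open>On arguments \<open>y\<close> and \<open>n\<close>, the index \<open>p'\<close>
    returns 0 if \<open>P\<close> holds at \<open>n\<close> and 1 otherwise. S5 on that number then
    stops with \<open>n\<close> through \<open>v\<close>, or goes on to the restart
    \<open>s\<close>. Self-reference arises by feeding \<open>d\<close> to itself as
    \<open>y\<close>.\<close>
  define d where "d = list_encode [4, list_encode [5, v, s], p']"
  have again: "kleene_rel d (T0 d # T0 n # \<Phi>) m"
    if E: "E x \<Phi>" and m: "if P n x then m = n else kleene_rel d (T0 d # T0 (Suc n) # \<Phi>) m"
    for n x \<Phi> m
    unfolding d_def
  proof (rule S4, rule p')
    let ?d = "list_encode [4, list_encode [5, v, s], p']"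
    show "kleene_rel p (T0 n # \<Phi>) (of_bool (\<not> P n x))" by (rule p[OF E])
    have *: "kleene_rel (list_encode [5, v, s]) (T0 0 # T0 ?d # T0 n # \<Phi>) n"
      by (intro S5_zero v L[OF E])
    show "kleene_rel (list_encode [5, v, s]) (T0 (of_bool (\<not> P n x)) # T0 ?d # T0 n # \<Phi>) m"
    proof (cases "P n x")
      case True
      with * m show ?thesis by simp
    next
      case False
      with m have "kleene_rel ?d (T0 ?d # T0 (Suc n) # \<Phi>) m" unfolding d_def by simp
      then have "kleene_rel s (T0 0 # T0 n # T0 ?d # T0 n # \<Phi>) m" by (rule s[OF L[OF E]])
      with S5_Suc[OF *] False show ?thesis by simp
    qed
  qed (use L[OF E] in simp)
  \<comment> \<open>Downward induction from the least witness: a run at a failing candidate is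
    derived from the run at its successor.\<close>
  have found: "kleene_rel d (T0 d # T0 k # \<Phi>) (LEAST n. P n x)"
    if E: "E x \<Phi>" and k: "k \<le> (LEAST n. P n x)" for k x \<Phi>
    using k
  proof (induction rule: inc_induct)
    case base
    have "P (LEAST n. P n x) x" using ex[OF E] by (rule LeastI_ex)
    then show ?case by (intro again[OF E]) simp
  next
    case (step k)
    have "\<not> P k x" using step.hyps(2) by (rule not_less_Least)
    with step.IH show ?case by (intro again[OF E]) simp
  qed
  have "kleene_rel (list_encode [4, list_encode [4, d, list_encode [2, d]], list_encode [2, 0]]) \<Phi>
      (LEAST n. P n x)" if "E x \<Phi>" for x \<Phi>
    by (rule S4[OF S2], rule S4[OF S2], rule found[OF that]) simp
  then show ?thesis unfolding computes_def by blast
qed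

section \<open>Application of functionals of type 2 and 3\<close>

lemma kleene_to_front:
  assumes "i < L"
  shows "\<exists>e'. \<forall>\<Phi> m. length \<Phi> = L \<longrightarrow> kleene_rel e (\<Phi> ! i # take i \<Phi> @ drop (Suc i) \<Phi>) m
    \<longrightarrow> kleene_rel e' \<Phi> m"
proof -
  let ?ps = "i # [0..<i] @ [Suc i..<L]"
  have eq: "map (\<lambda>j. \<Phi> ! j) ?ps = \<Phi> ! i # take i \<Phi> @ drop (Suc i) \<Phi>" if "length \<Phi> = L" for \<Phi> :: "obj list"
  proof -
    have "map (\<lambda>j. \<Phi> ! j) [0..<i] = take i \<Phi>" "map (\<lambda>j. \<Phi> ! j) [Suc i..<L] = drop (Suc i) \<Phi>"
      using that assms by (auto intro!: nth_equalityI simp del: upt_Suc)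
    then show ?thesis by simp
  qed
  have "\<exists>e'. \<forall>\<Phi> m. length \<Phi> = L \<longrightarrow> kleene_rel e (map (\<lambda>j. \<Phi> ! j) ?ps) m \<longrightarrow> kleene_rel e' \<Phi> m"
    using assms by (intro kleene_select) auto
  then show ?thesis by (simp only: eq cong: imp_cong)
qed

text \<open>S8 keeps its functional at the head and puts the bound variable before it. An index
  written for the original order is adapted here to the order which this produces.\<close>

lemma kleene_from_front:
  assumes "i < L"
  shows "\<exists>e'. \<forall>a \<Phi> m. length \<Phi> = L \<longrightarrow> kleene_rel e (a # \<Phi>) m
    \<longrightarrow> kleene_rel e' (a # \<Phi> ! i # take i \<Phi> @ drop (Suc i) \<Phi>) m"
proof -
  let ?ps = "0 # [2..<i + 2] @ 1 # [i + 2..<Suc L]"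
  have "\<exists>e'. \<forall>\<Phi> m. length \<Phi> = Suc L \<longrightarrow> kleene_rel e (map (\<lambda>i. \<Phi> ! i) ?ps) m \<longrightarrow> kleene_rel e' \<Phi> m"
    using assms by (intro kleene_select) (auto simp del: upt_Suc)
  then obtain e' where e': "\<And>\<Phi> m. length \<Phi> = Suc L \<Longrightarrow> kleene_rel e (map (\<lambda>i. \<Phi> ! i) ?ps) m \<Longrightarrow> kleene_rel e' \<Phi> m"
    by blast
  have "kleene_rel e' (a # \<Phi> ! i # take i \<Phi> @ drop (Suc i) \<Phi>) m"
    if len: "length \<Phi> = L" and e: "kleene_rel e (a # \<Phi>) m" for a \<Phi> m
  proof (rule e')
    let ?\<Psi> = "a # \<Phi> ! i # take i \<Phi> @ drop (Suc i) \<Phi>"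
    have "map (\<lambda>j. ?\<Psi> ! j) [2..<i + 2] = take i \<Phi>"
      using len assms by (auto intro!: nth_equalityI simp del: upt_Suc simp: nth_append)
    moreover have "map (\<lambda>j. ?\<Psi> ! j) [i + 2..<Suc L] = drop (Suc i) \<Phi>"
      using len assms by (auto intro!: nth_equalityI simp del: upt_Suc simp: nth_append)
    moreover have "take i \<Phi> @ \<Phi> ! i # drop (Suc i) \<Phi> = \<Phi>"
      using len assms by (simp add: id_take_nth_drop[symmetric])
    ultimately have "map (\<lambda>j. ?\<Psi> ! j) ?ps = a # \<Phi>" by (simp del: upt_Suc)
    with e show "kleene_rel e (map (\<lambda>j. (a # \<Phi> ! i # take i \<Phi> @ drop (Suc i) \<Phi>) ! j) ?ps) m"
      by metis
  qed (use len assms in simp)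
  then show ?thesis by blast
qed

lemma computes_app2:
  assumes "good_ctx E" "has2 E \<Psi>" "computes (num_ctx E) (\<lambda>z. h (fst z) (snd z))"
    and app: "\<And>x \<Phi>. E x \<Phi> \<Longrightarrow> \<Psi> x (\<lambda>n. h n x) = Some (g x)"
  shows "computes E g"
proof (cases "\<exists>x \<Phi>. E x \<Phi>")
  \<comment> \<open>An inhabitant bounds the position \<open>i\<close> by the common length
    \<open>L\<close>; over an empty context every index will do.\<close>
  case True
  obtain L where L: "\<And>x \<Phi>. E x \<Phi> \<Longrightarrow> length \<Phi> = L" using good_ctxE[OF assms(1)] by blast
  obtain i where i: "\<And>x \<Phi>. E x \<Phi> \<Longrightarrow> i < length \<Phi> \<and> \<Phi> ! i = T2 (\<Psi> x)"
    using assms(2) unfolding has2_def by blast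
  with True L have "i < L" by blast
  obtain d where d: "\<And>n x \<Phi>. E x \<Phi> \<Longrightarrow> kleene_rel d (T0 n # \<Phi>) (h n x)"
    using computes_numE[OF assms(3), unfolded fst_conv snd_conv] by blast
  obtain d' where d': "\<And>a \<Phi> m. length \<Phi> = L \<Longrightarrow> kleene_rel d (a # \<Phi>) m \<Longrightarrow>
      kleene_rel d' (a # \<Phi> ! i # take i \<Phi> @ drop (Suc i) \<Phi>) m"
    using kleene_from_front[OF \<open>i < L\<close>] by metis
  obtain e where e: "\<And>\<Phi> m. length \<Phi> = L \<Longrightarrow>
      kleene_rel (list_encode [8, d']) (\<Phi> ! i # take i \<Phi> @ drop (Suc i) \<Phi>) m \<Longrightarrow> kleene_rel e \<Phi> m"
    using kleene_to_front[OF \<open>i < L\<close>] by metis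
  have "kleene_rel e \<Phi> (g x)" if E: "E x \<Phi>" for x \<Phi>
  proof (rule e[OF L[OF E]])
    have "kleene_rel d' (T0 n # \<Phi> ! i # take i \<Phi> @ drop (Suc i) \<Phi>) (h n x)" for n
      by (intro d' L[OF E] d E)
    then show "kleene_rel (list_encode [8, d']) (\<Phi> ! i # take i \<Phi> @ drop (Suc i) \<Phi>) (g x)"
      using i[OF E] app[OF E] S8_2[of d' "\<Psi> x" _ "\<lambda>n. h n x"] by simp
  qed
  then show ?thesis unfolding computes_def by blast
qed (auto simp: computes_def)

lemma computes_app3:
  assumes "good_ctx E" "has3 E \<Psi>" "computes (fun_ctx E) (\<lambda>z. G (fst z) (snd z))"
    and app: "\<And>x \<Phi>. E x \<Phi> \<Longrightarrow> \<Psi> x (\<lambda>f. G f x) = Some (g x)"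
  shows "computes E g"
proof (cases "\<exists>x \<Phi>. E x \<Phi>")
  case True
  obtain L where L: "\<And>x \<Phi>. E x \<Phi> \<Longrightarrow> length \<Phi> = L" using good_ctxE[OF assms(1)] by blast
  obtain i where i: "\<And>x \<Phi>. E x \<Phi> \<Longrightarrow> i < length \<Phi> \<and> \<Phi> ! i = T3 (\<Psi> x)"
    using assms(2) unfolding has3_def by blast
  with True L have "i < L" by blast
  obtain d where d: "\<And>f x \<Phi>. E x \<Phi> \<Longrightarrow> kleene_rel d (T1 f # \<Phi>) (G f x)"
    using computes_funE[OF assms(3), unfolded fst_conv snd_conv] by blast
  obtain d' where d': "\<And>a \<Phi> m. length \<Phi> = L \<Longrightarrow> kleene_rel d (a # \<Phi>) m \<Longrightarrow>
      kleene_rel d' (a # \<Phi> ! i # take i \<Phi> @ drop (Suc i) \<Phi>) m"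
    using kleene_from_front[OF \<open>i < L\<close>] by metis
  obtain e where e: "\<And>\<Phi> m. length \<Phi> = L \<Longrightarrow>
      kleene_rel (list_encode [8, d']) (\<Phi> ! i # take i \<Phi> @ drop (Suc i) \<Phi>) m \<Longrightarrow> kleene_rel e \<Phi> m"
    using kleene_to_front[OF \<open>i < L\<close>] by metis
  have "kleene_rel e \<Phi> (g x)" if E: "E x \<Phi>" for x \<Phi>
  proof (rule e[OF L[OF E]])
    have "kleene_rel d' (T1 f # \<Phi> ! i # take i \<Phi> @ drop (Suc i) \<Phi>) (G f x)" for f
      by (intro d' L[OF E] d E)
    then show "kleene_rel (list_encode [8, d']) (\<Phi> ! i # take i \<Phi> @ drop (Suc i) \<Phi>) (g x)"
      using i[OF E] app[OF E] S8_3[of d' "\<Psi> x" _ "\<lambda>f. G f x"] by simp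
  qed
  then show ?thesis unfolding computes_def by blast
qed (auto simp: computes_def)

section \<open>Predicates decidable with the help of \<open>exists2\<close>\<close>

lemma computes_cong: "computes E g \<Longrightarrow> (\<And>x. g x = h x) \<Longrightarrow> computes E h"
  unfolding computes_def by simp

lemma dec_cong: "dec E P \<Longrightarrow> (\<And>x. P x \<longleftrightarrow> Q x) \<Longrightarrow> dec E Q"
  unfolding dec_def by (rule computes_cong) auto

lemma dec_sub: "dec E P \<Longrightarrow> dec (sub_ctx E Q) P"
  unfolding dec_def by (rule computes_sub)

lemma computes_if:
  "good_ctx E \<Longrightarrow> dec E P \<Longrightarrow> computes E a \<Longrightarrow> computes E b \<Longrightarrow> computes E (\<lambda>x. if P x then a x else b x)"
  by (intro computes_if_lazy computes_sub)

lemma dec_not: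
  assumes "good_ctx E" "dec E P"
  shows "dec E (\<lambda>x. \<not> P x)"
  unfolding dec_def
  by (rule computes_cong, rule computes_if[OF assms computes_const[of _ 0] computes_const[of _ 1]]) simp

text \<open>\<open>Q\<close> is the branch evaluated only if \<open>P\<close> holds, so it may
  involve values that are defined only there.\<close>

lemma dec_conj_lazy:
  assumes "good_ctx E" "dec E P" "dec (sub_ctx E P) Q"
  shows "dec E (\<lambda>x. P x \<and> Q x)"
  unfolding dec_def
  by (rule computes_cong, rule computes_if_lazy[OF assms[unfolded dec_def[of _ Q]] computes_const[of _ 0]]) simp

lemma dec_conj: "good_ctx E \<Longrightarrow> dec E P \<Longrightarrow> dec E Q \<Longrightarrow> dec E (\<lambda>x. P x \<and> Q x)"
  by (intro dec_conj_lazy dec_sub)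

lemma dec_disj:
  assumes "good_ctx E" "dec E P" "dec E Q"
  shows "dec E (\<lambda>x. P x \<or> Q x)"
  by (rule dec_cong[where P = "\<lambda>x. \<not> (\<not> P x \<and> \<not> Q x)"], intro dec_not dec_conj assms) simp

lemma dec_imp:
  assumes "good_ctx E" "dec E P" "dec E Q"
  shows "dec E (\<lambda>x. P x \<longrightarrow> Q x)"
  by (rule dec_cong[where P = "\<lambda>x. \<not> (P x \<and> \<not> Q x)"], intro dec_not dec_conj assms) simp

lemma dec_iff:
  assumes "good_ctx E" "dec E P" "dec E Q"
  shows "dec E (\<lambda>x. P x \<longleftrightarrow> Q x)"
  by (rule dec_cong[where P = "\<lambda>x. (P x \<and> Q x) \<or> (\<not> P x \<and> \<not> Q x)"],
      intro dec_not dec_conj dec_disj assms) auto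

text \<open>\<open>exists2\<close> looks for a zero and answers 0 on success, so it is given the
  characteristic function of the negation and its answer is negated.\<close>

lemma dec_ex:
  assumes "good_ctx E" "dec (num_ctx E) (\<lambda>z. P (fst z) (snd z))"
  shows "dec E (\<lambda>x. \<exists>n. P n x)"
proof -
  have "computes E (\<lambda>x. exists2 (\<lambda>n. of_bool (\<not> P n x)))"
  proof (rule computes_app2)
    show "computes (num_ctx E) (\<lambda>z. of_bool (\<not> P (fst z) (snd z)))"
      using dec_not[OF good_num assms(2)] assms(1) unfolding dec_def by simp
    show "has2 E (\<lambda>x f. Some (exists2 f))" using assms(1) unfolding good_ctx_def by simp
  qed (use assms in auto)
  then have "dec E (\<lambda>x. \<not> (\<exists>n. P n x))"
    unfolding dec_def by (rule computes_cong) (simp add: exists2_def)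
  from dec_not[OF assms(1) this] show ?thesis by simp
qed

lemma dec_all:
  assumes "good_ctx E" "dec (num_ctx E) (\<lambda>z. P (fst z) (snd z))"
  shows "dec E (\<lambda>x. \<forall>n. P n x)"
  using dec_not[OF assms(1) dec_ex[OF assms(1) dec_not[OF good_num[OF assms(1)] assms(2)]]] by simp

section \<open>Arithmetic and pairing of natural numbers\<close>

lemma computes_add:
  assumes "good_ctx E" "computes E a" "computes E b"
  shows "computes E (\<lambda>x. a x + b x)"
proof (rule computes_cong)
  show "computes E (\<lambda>x. rec_nat (a x) (\<lambda>n r. Suc r) (b x))"
    by (intro computes_rec computes_Suc computes_weaken_num computes_num_var good_num assms)
  have "rec_nat c (\<lambda>n r. Suc r) m = c + m" for c m :: nat
    by (induction m) auto
  then show "rec_nat (a x) (\<lambda>n r. Suc r) (b x) = a x + b x" for x .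
qed

lemma computes_mult:
  assumes "good_ctx E" "computes E a" "computes E b"
  shows "computes E (\<lambda>x. a x * b x)"
proof (rule computes_cong)
  show "computes E (\<lambda>x. rec_nat 0 (\<lambda>n r. r + a x) (b x))"
    by (intro computes_rec computes_add computes_const computes_weaken_num computes_num_var good_num assms)
  have "rec_nat 0 (\<lambda>n r. r + c) m = c * m" for c m :: nat
    by (induction m) auto
  then show "rec_nat 0 (\<lambda>n r. r + a x) (b x) = a x * b x" for x .
qed

lemma computes_power2:
  assumes "good_ctx E" "computes E a"
  shows "computes E (\<lambda>x. 2 ^ a x)"
proof (rule computes_cong)
  show "computes E (\<lambda>x. rec_nat 1 (\<lambda>n r. r + r) (a x))"
    by (intro computes_rec computes_add computes_const computes_weaken_num computes_num_var good_num assms)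
  have "rec_nat 1 (\<lambda>n r. r + r) m = (2 :: nat) ^ m" for m :: nat
    by (induction m) auto
  then show "rec_nat 1 (\<lambda>n r. r + r) (a x) = (2 :: nat) ^ a x" for x .
qed

lemma computes_diff:
  assumes "good_ctx E" "computes E a" "computes E b"
  shows "computes E (\<lambda>x. a x - b x)"
proof (rule computes_cong)
  \<comment> \<open>The inner recursion is the predecessor with value 0 at 0, whose iteration is
    truncated subtraction.\<close>
  show "computes E (\<lambda>x. rec_nat (a x) (\<lambda>n r. rec_nat 0 (\<lambda>n r. n) r) (b x))"
    by (intro computes_rec computes_const computes_weaken_num computes_num_var good_num assms)
  have "rec_nat 0 (\<lambda>n r. n) k = k - 1" for k :: nat
    by (cases k) auto
  then have "rec_nat c (\<lambda>n r. rec_nat 0 (\<lambda>n r. n) r) m = c - m" for c m :: nat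
    by (induction m) auto
  then show "rec_nat (a x) (\<lambda>n r. rec_nat 0 (\<lambda>n r. n) r) (b x) = a x - b x" for x .
qed

lemma dec_less:
  assumes "good_ctx E" "computes E a" "computes E b"
  shows "dec E (\<lambda>x. a x < b x)"
  unfolding dec_def
proof (rule computes_cong)
  show "computes E (\<lambda>x. rec_nat 0 (\<lambda>n r. 1) (b x - a x))"
    by (intro computes_rec computes_const computes_diff assms)
  have eq: "rec_nat 0 (\<lambda>n r. 1) m = (of_bool (0 < m) :: nat)" for m
    by (cases m) auto
  show "rec_nat 0 (\<lambda>n r. 1) (b x - a x) = (of_bool (a x < b x) :: nat)" for x
    using eq[of "b x - a x"] by (simp only: zero_less_diff)
qed

lemma dec_le: "good_ctx E \<Longrightarrow> computes E a \<Longrightarrow> computes E b \<Longrightarrow> dec E (\<lambda>x. a x \<le> b x)"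
  for a b :: "_ \<Rightarrow> nat"
  using dec_not[OF _ dec_less, of E b a] by (simp add: not_less)

lemma dec_eq: "good_ctx E \<Longrightarrow> computes E a \<Longrightarrow> computes E b \<Longrightarrow> dec E (\<lambda>x. a x = b x)"
  for a b :: "_ \<Rightarrow> nat"
  using dec_conj[OF _ dec_le dec_le, of E a b b a] by (simp add: order_eq_iff)

lemmas computes_intros = good_num good_fun good_sub computes_const computes_num_var
  computes_Suc computes_add computes_mult computes_power2 computes_diff computes_if
  dec_not dec_conj dec_disj dec_imp dec_iff dec_ex dec_all dec_less dec_le dec_eq
  computes_weaken_num computes_weaken_fun

lemma computes_div2:
  assumes "good_ctx E" "computes E a"
  shows "computes E (\<lambda>x. a x div 2)"
proof (rule computes_cong)
  show "computes E (\<lambda>x. LEAST k. a x < 2 * k + 2)"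
    by (rule computes_Least; (intro computes_intros assms)?) presburger
  have "(LEAST k. n < 2 * k + 2) = n div 2" for n :: nat
    by (rule Least_equality) linarith+
  then show "(LEAST k. a x < 2 * k + 2) = a x div 2" for x .
qed

lemma dec_even:
  assumes "good_ctx E" "computes E a"
  shows "dec E (\<lambda>x. even (a x))"
  unfolding dvd_def by (intro computes_intros assms)

lemma computes_prod_encode:
  assumes "good_ctx E" "computes E a" "computes E b"
  shows "computes E (\<lambda>x. prod_encode (a x, b x))"
proof (rule computes_cong)
  show "computes E (\<lambda>x. ((a x + b x) * Suc (a x + b x)) div 2 + a x)"
    by (intro computes_intros computes_div2 assms)
qed (simp add: prod_encode_def triangle_def)

lemma computes_fst_prod_decode:
  assumes "good_ctx E" "computes E a"
  shows "computes E (\<lambda>x. fst (prod_decode (a x)))"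
proof (rule computes_cong)
  show "computes E (\<lambda>x. LEAST k. \<exists>l. prod_encode (k, l) = a x)"
    by (rule computes_Least; (intro computes_intros computes_prod_encode assms)?)
      (metis prod_decode_inverse surj_pair)
  have "(LEAST k. \<exists>l. prod_encode (k, l) = n) = fst (prod_decode n)" for n
    by (rule Least_equality) (auto intro: exI[of _ "snd (prod_decode n)"])
  then show "(LEAST k. \<exists>l. prod_encode (k, l) = a x) = fst (prod_decode (a x))" for x .
qed

lemma computes_snd_prod_decode:
  assumes "good_ctx E" "computes E a"
  shows "computes E (\<lambda>x. snd (prod_decode (a x)))"
proof (rule computes_cong)
  show "computes E (\<lambda>x. LEAST l. \<exists>k. prod_encode (k, l) = a x)"
    by (rule computes_Least; (intro computes_intros computes_prod_encode assms)?)
      (metis prod_decode_inverse surj_pair)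
  have "(LEAST l. \<exists>k. prod_encode (k, l) = n) = snd (prod_decode n)" for n
    by (rule Least_equality) (auto intro: exI[of _ "fst (prod_decode n)"])
  then show "(LEAST l. \<exists>k. prod_encode (k, l) = a x) = snd (prod_decode (a x))" for x .
qed

section \<open>Rational numbers and codes of reals\<close>

definition rv :: "nat \<Rightarrow> real" where
  "rv m = of_rat (nat_to_rat_surj m)"

text \<open>A rational is handled as a difference of natural numbers over a positive natural number,
  so no integer arithmetic is needed. The components of the pair are encoded integers:
  \<open>n\<close> stands for absolute value \<open>Suc n div 2\<close>, with non-negative sign iff
  \<open>n\<close> is even. Denominator 0 gives the rational 0, hence the numerators 0 here and the
  denominator 1 in \<open>denom\<close>.\<close>

definition num_pos :: "nat \<Rightarrow> nat" where
  "num_pos m = (let a = fst (prod_decode m); b = snd (prod_decode m)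
     in if b \<noteq> 0 \<and> (even a \<longleftrightarrow> even b) then Suc a div 2 else 0)"

definition num_neg :: "nat \<Rightarrow> nat" where
  "num_neg m = (let a = fst (prod_decode m); b = snd (prod_decode m)
     in if b \<noteq> 0 \<and> \<not> (even a \<longleftrightarrow> even b) then Suc a div 2 else 0)"

definition denom :: "nat \<Rightarrow> nat" where
  "denom m = (let b = snd (prod_decode m) in if b = 0 then 1 else Suc b div 2)"

text \<open>Integers are encoded as \<open>2 * k\<close> for \<open>k\<close> and
  \<open>2 * k - 1\<close> for \<open>- k\<close>; the case distinction keeps truncated subtraction
  exact. Below, \<open>rcode 0 0 1\<close> and \<open>rcode 1 0 1\<close> serve as the constants 0
  and 1.\<close>

definition rcode :: "nat \<Rightarrow> nat \<Rightarrow> nat \<Rightarrow> nat" where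
  "rcode p n d = prod_encode (if n \<le> p then 2 * (p - n) else 2 * (n - p) - 1, 2 * d)"

definition radd :: "nat \<Rightarrow> nat \<Rightarrow> nat" where
  "radd a b = rcode (num_pos a * denom b + num_pos b * denom a)
     (num_neg a * denom b + num_neg b * denom a) (denom a * denom b)"

definition rhalf :: "nat \<Rightarrow> nat" where
  "rhalf n = rcode 1 0 (2 ^ n)"

lemma denom_pos: "0 < denom m"
  by (auto simp: denom_def Let_def)

lemma int_decode_eq: "int_decode n = (if even n then int (Suc n div 2) else - int (Suc n div 2))"
  by (auto simp: int_decode_def sum_decode_def elim: oddE)

lemma rv_prod_encode: "rv (prod_encode (a, b)) = of_int (int_decode a) / of_int (int_decode b)"
  by (simp add: rv_def nat_to_rat_surj_def Fract_of_int_quotient of_rat_divide)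

lemma rv_eq: "rv m = (real (num_pos m) - real (num_neg m)) / real (denom m)"
proof -
  obtain a b where m: "prod_decode m = (a, b)" by force
  define A B where "A = Suc a div 2" and "B = Suc b div 2"
  have "rv m = of_int (int_decode a) / of_int (int_decode b)"
    by (metis m prod_decode_inverse rv_prod_encode)
  also have "\<dots> = (if even a then real A else - real A) / (if even b then real B else - real B)"
    unfolding int_decode_eq A_def B_def by simp
  also have "\<dots> = (if b = 0 then 0 else (if even a \<longleftrightarrow> even b then real A else - real A) / real B)"
    by (cases "b = 0") (simp add: B_def, simp)
  also have "\<dots> = (real (num_pos m) - real (num_neg m)) / real (denom m)"
    by (simp add: num_pos_def num_neg_def denom_def m flip: A_def B_def)
  finally show ?thesis .
qed

lemma rv_rcode:
  assumes "0 < d"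
  shows "rv (rcode p n d) = (real p - real n) / real d"
proof (cases "n \<le> p")
  case True
  then have "int_decode (2 * (p - n)) = int p - int n" by (simp add: int_decode_eq of_nat_diff)
  with True show ?thesis by (simp add: rcode_def rv_prod_encode int_decode_eq[of "2 * d"])
next
  case False
  then have "odd (2 * (n - p) - 1)" "Suc (2 * (n - p) - 1) = 2 * (n - p)" by auto
  then have "int_decode (2 * (n - p) - 1) = int p - int n"
    using False unfolding int_decode_eq by (simp add: of_nat_diff)
  with False show ?thesis by (simp add: rcode_def rv_prod_encode int_decode_eq[of "2 * d"])
qed

lemma rv_radd: "rv (radd a b) = rv a + rv b"
proof -
  have "real (denom a) \<noteq> 0" "real (denom b) \<noteq> 0" "0 < denom a * denom b"
    using denom_pos[of a] denom_pos[of b] by auto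
  then show ?thesis
    by (simp add: radd_def rv_rcode rv_eq[of a] rv_eq[of b] add_frac_eq) (simp add: algebra_simps)
qed

lemma rv_rhalf: "rv (rhalf n) = 1 / 2 ^ n"
  by (simp add: rhalf_def rv_rcode)

text \<open>Cross-multiplication, with the negative parts moved to the other side so that the
  comparison takes place in the natural numbers.\<close>

lemma rv_le: "rv a \<le> rv b \<longleftrightarrow>
    num_pos a * denom b + num_neg b * denom a \<le> num_pos b * denom a + num_neg a * denom b"
proof -
  have "0 < real (denom a)" "0 < real (denom b)"
    using denom_pos by auto
  then have "rv a \<le> rv b \<longleftrightarrow> (real (num_pos a) - real (num_neg a)) * real (denom b)
      \<le> (real (num_pos b) - real (num_neg b)) * real (denom a)"
    unfolding rv_eq by (simp add: pos_divide_le_eq pos_le_divide_eq)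
  also have "\<dots> \<longleftrightarrow> real (num_pos a * denom b + num_neg b * denom a)
      \<le> real (num_pos b * denom a + num_neg a * denom b)"
    by (simp add: algebra_simps)
  finally show ?thesis by (simp only: of_nat_le_iff)
qed

lemma rv_surj: "q \<in> \<rat> \<Longrightarrow> \<exists>m. rv m = q"
  unfolding rv_def Rats_def
  by (metis imageE surj_nat_to_rat_surj surjD)

lemma computes_num_pos: "good_ctx E \<Longrightarrow> computes E a \<Longrightarrow> computes E (\<lambda>x. num_pos (a x))"
  unfolding num_pos_def Let_def
  by (intro computes_intros dec_even computes_div2 computes_fst_prod_decode computes_snd_prod_decode)

lemma computes_num_neg: "good_ctx E \<Longrightarrow> computes E a \<Longrightarrow> computes E (\<lambda>x. num_neg (a x))"
  unfolding num_neg_def Let_def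
  by (intro computes_intros dec_even computes_div2 computes_fst_prod_decode computes_snd_prod_decode)

lemma computes_denom: "good_ctx E \<Longrightarrow> computes E a \<Longrightarrow> computes E (\<lambda>x. denom (a x))"
  unfolding denom_def Let_def
  by (intro computes_intros dec_even computes_div2 computes_snd_prod_decode)

lemma computes_rcode:
  "good_ctx E \<Longrightarrow> computes E p \<Longrightarrow> computes E n \<Longrightarrow> computes E d \<Longrightarrow> computes E (\<lambda>x. rcode (p x) (n x) (d x))"
  unfolding rcode_def by (intro computes_intros computes_prod_encode)

lemma computes_radd: "good_ctx E \<Longrightarrow> computes E a \<Longrightarrow> computes E b \<Longrightarrow> computes E (\<lambda>x. radd (a x) (b x))"
  unfolding radd_def
  by (intro computes_rcode computes_add computes_mult computes_num_pos computes_num_neg computes_denom)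

lemma computes_rhalf: "good_ctx E \<Longrightarrow> computes E a \<Longrightarrow> computes E (\<lambda>x. rhalf (a x))"
  unfolding rhalf_def by (intro computes_rcode computes_const computes_power2)

lemma dec_rv_le: "good_ctx E \<Longrightarrow> computes E a \<Longrightarrow> computes E b \<Longrightarrow> dec E (\<lambda>x. rv (a x) \<le> rv (b x))"
  unfolding rv_le
  by (intro dec_le computes_add computes_mult computes_num_pos computes_num_neg computes_denom)

lemma dec_rv_less: "good_ctx E \<Longrightarrow> computes E a \<Longrightarrow> computes E b \<Longrightarrow> dec E (\<lambda>x. rv (a x) < rv (b x))"
  using dec_not[OF _ dec_rv_le, of E b a] by (simp add: not_le)

section \<open>Codes of reals and decidable tests on them\<close>

lemma codes_iff:
  "codes \<alpha> x \<longleftrightarrow> (\<forall>n i. \<bar>rv (\<alpha> n) - rv (\<alpha> (n + i))\<bar> < 1 / 2 ^ n) \<and> (\<lambda>n. rv (\<alpha> n)) \<longlonglongrightarrow> x"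
  by (simp add: codes_def rv_def)

lemma codes_const: "codes (\<lambda>_. m) (rv m)"
  by (simp add: codes_iff)

lemma codes_radd: "codes \<alpha> x \<Longrightarrow> codes (\<lambda>n. radd c (\<alpha> n)) (rv c + x)"
  by (auto simp: codes_iff rv_radd intro: tendsto_intros)

text \<open>The strict Cauchy bounds pass to the limit in \<open>i\<close> as a weak
  inequality.\<close>

lemma codes_approx:
  assumes "codes \<alpha> x"
  shows "\<bar>rv (\<alpha> n) - x\<bar> \<le> 1 / 2 ^ n"
proof -
  have "(\<lambda>i. rv (\<alpha> (n + i))) \<longlonglongrightarrow> x"
    using assms LIMSEQ_ignore_initial_segment[of "\<lambda>n. rv (\<alpha> n)" x n] by (simp add: codes_iff add.commute)
  then have "(\<lambda>i. \<bar>rv (\<alpha> n) - rv (\<alpha> (n + i))\<bar>) \<longlonglongrightarrow> \<bar>rv (\<alpha> n) - x\<bar>"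
    by (intro tendsto_intros)
  then show ?thesis
    by (rule LIMSEQ_le_const2) (use assms in \<open>auto simp: codes_iff intro: less_imp_le\<close>)
qed

text \<open>The tolerance is twice \<open>1 / 2 ^ k\<close> because each of two codes of the same
  real errs by at most \<open>1 / 2 ^ k\<close> at index \<open>k\<close>. The only quantifier
  ranges over numbers.\<close>

definition real_eq :: "type1 \<Rightarrow> type1 \<Rightarrow> bool" where
  "real_eq \<alpha> \<beta> \<longleftrightarrow> (\<forall>k. rv (\<alpha> k) \<le> rv (radd (\<beta> k) (radd (rhalf k) (rhalf k))) \<and>
     rv (\<beta> k) \<le> rv (radd (\<alpha> k) (radd (rhalf k) (rhalf k))))"

lemma real_eq_iff:
  assumes "codes \<alpha> x" "codes \<beta> y"
  shows "real_eq \<alpha> \<beta> \<longleftrightarrow> x = y"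
proof
  assume "x = y"
  show "real_eq \<alpha> \<beta>"
    unfolding real_eq_def rv_radd rv_rhalf
  proof
    show "rv (\<alpha> k) \<le> rv (\<beta> k) + (1 / 2 ^ k + 1 / 2 ^ k) \<and> rv (\<beta> k) \<le> rv (\<alpha> k) + (1 / 2 ^ k + 1 / 2 ^ k)" for k
      using codes_approx[OF assms(1), of k] codes_approx[OF assms(2), of k] \<open>x = y\<close> by linarith
  qed
next
  assume eq: "real_eq \<alpha> \<beta>"
  \<comment> \<open>The tolerance and the two approximation errors add up to four times
    \<open>1 / 2 ^ k\<close>, which tends to 0.\<close>
  have bound: "\<bar>x - y\<bar> \<le> 4 * (1 / 2) ^ k" for k
  proof -
    have "rv (\<alpha> k) \<le> rv (\<beta> k) + (1 / 2 ^ k + 1 / 2 ^ k)" "rv (\<beta> k) \<le> rv (\<alpha> k) + (1 / 2 ^ k + 1 / 2 ^ k)"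
      using eq unfolding real_eq_def rv_radd rv_rhalf by auto
    then have "\<bar>x - y\<bar> \<le> 4 * (1 / 2 ^ k)"
      using codes_approx[OF assms(1), of k] codes_approx[OF assms(2), of k] by linarith
    then show ?thesis by (simp add: power_one_over)
  qed
  have "(\<lambda>k. 4 * (1 / 2 :: real) ^ k) \<longlonglongrightarrow> 4 * 0"
    by (intro tendsto_intros) auto
  then have "\<bar>x - y\<bar> \<le> 4 * 0"
    by (rule LIMSEQ_le_const) (use bound in blast)
  then show "x = y" by simp
qed

lemma dec_real_eq:
  assumes "good_ctx E" "computes1 E \<alpha>" "computes1 E \<beta>"
  shows "dec E (\<lambda>x. real_eq (\<alpha> x) (\<beta> x))"
  unfolding real_eq_def
  by (intro dec_all dec_conj dec_rv_le computes_radd computes_rhalf computes_num_var good_num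
      assms assms(2,3)[unfolded computes1_def])

text \<open>All quantifiers range over numbers. The slack in the second part is due to rational
  approximations that leave the unit interval although their limit lies in it.\<close>

definition unit_code :: "type1 \<Rightarrow> bool" where
  "unit_code \<alpha> \<longleftrightarrow>
     (\<forall>n i. rv (\<alpha> n) < rv (radd (\<alpha> (n + i)) (rhalf n)) \<and> rv (\<alpha> (n + i)) < rv (radd (\<alpha> n) (rhalf n))) \<and>
     (\<forall>n. rv (rcode 0 0 1) \<le> rv (radd (\<alpha> n) (rhalf n)) \<and> rv (\<alpha> n) \<le> rv (radd (rcode 1 0 1) (rhalf n)))"

lemma unit_code_iff: "unit_code \<alpha> \<longleftrightarrow> (\<exists>x\<in>{0..1}. codes \<alpha> x)"
proof
  assume \<alpha>: "unit_code \<alpha>"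
  have cauchy: "\<bar>rv (\<alpha> n) - rv (\<alpha> (n + i))\<bar> < 1 / 2 ^ n" for n i
    using \<alpha> unfolding unit_code_def rv_radd rv_rhalf abs_less_iff by (smt (verit, best))
  have bounds: "0 \<le> rv (\<alpha> n) + 1 / 2 ^ n" "rv (\<alpha> n) \<le> 1 + 1 / 2 ^ n" for n
    using \<alpha> unfolding unit_code_def rv_radd rv_rhalf by (simp_all add: rv_rcode)
  have half: "(\<lambda>n. 1 / 2 ^ n :: real) \<longlonglongrightarrow> 0"
    using LIMSEQ_power_zero[of "1 / 2 :: real"] by (simp add: power_one_over)
  have "Cauchy (\<lambda>n. rv (\<alpha> n))"
  proof (rule CauchyI')
    fix e :: real assume "0 < e"
    then obtain N where N: "1 / 2 ^ N < e / 2"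
      using real_arch_pow_inv[of "e / 2" "1 / 2"] by (auto simp: power_one_over)
    have "dist (rv (\<alpha> m)) (rv (\<alpha> n)) < e" if "N \<le> m" "m < n" for m n
      using cauchy[of N "m - N"] cauchy[of N "n - N"] that N by (simp add: dist_real_def)
    then show "\<exists>M. \<forall>m\<ge>M. \<forall>n>m. dist (rv (\<alpha> m)) (rv (\<alpha> n)) < e" by blast
  qed
  then obtain x where x: "(\<lambda>n. rv (\<alpha> n)) \<longlonglongrightarrow> x"
    using real_Cauchy_convergent convergent_def by blast
  have "0 \<le> x + 0"
    using bounds(1) by (intro LIMSEQ_le_const[OF tendsto_add[OF x half]]) auto
  moreover have "x \<le> 1 + 0"
    using bounds(2) by (intro LIMSEQ_le[OF x tendsto_add[OF tendsto_const half]]) auto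
  ultimately show "\<exists>x\<in>{0..1}. codes \<alpha> x"
    using x cauchy by (intro bexI[of _ x]) (auto simp: codes_iff)
next
  assume "\<exists>x\<in>{0..1}. codes \<alpha> x"
  then obtain x where x: "0 \<le> x" "x \<le> 1" "codes \<alpha> x" by auto
  have "rv (\<alpha> n) < rv (\<alpha> (n + i)) + 1 / 2 ^ n" "rv (\<alpha> (n + i)) < rv (\<alpha> n) + 1 / 2 ^ n" for n i
    using x(3) unfolding codes_iff abs_less_iff by (smt (verit, best))+
  moreover have "0 \<le> rv (\<alpha> n) + 1 / 2 ^ n" "rv (\<alpha> n) \<le> 1 + 1 / 2 ^ n" for n
    using codes_approx[OF x(3), of n] x(1,2) by linarith+
  ultimately show "unit_code \<alpha>"
    unfolding unit_code_def rv_radd rv_rhalf by (simp add: rv_rcode)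
qed

lemma dec_unit_code:
  assumes "good_ctx E" "computes1 E \<alpha>"
  shows "dec E (\<lambda>x. unit_code (\<alpha> x))"
proof -
  have 1: "computes1 (num_ctx E) (\<lambda>z. \<alpha> (snd z))"
    by (intro computes1_weaken_num assms)
  have 2: "computes1 (num_ctx (num_ctx E)) (\<lambda>z. \<alpha> (snd (snd z)))"
    by (intro computes1_weaken_num good_num assms)
  show ?thesis
    unfolding unit_code_def
    by (intro dec_all dec_conj dec_rv_le dec_rv_less computes_radd computes_rhalf computes1_app[OF 1]
        computes1_app[OF 2] computes_const computes_add computes_num_var computes_weaken_num good_num assms)
qed

section \<open>The oscillation of a tower of dense open sets\<close>

definition tower :: "(nat \<Rightarrow> real set) \<Rightarrow> real \<Rightarrow> real" where
  "tower U x = (if \<forall>n. x \<in> U n then 0 else 1 / 2 ^ (LEAST n. x \<notin> U n))"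

lemma tower_bounds: "0 \<le> tower U x" "tower U x \<le> 1"
  by (auto simp: tower_def)

lemma tower_ge_iff: "1 / 2 ^ n \<le> tower U x \<longleftrightarrow> (\<exists>i\<le>n. x \<notin> U i)"
proof (cases "\<forall>n. x \<in> U n")
  case False
  let ?m = "LEAST n. x \<notin> U n"
  have "tower U x = 1 / 2 ^ ?m" using False unfolding tower_def by (rule if_not_P)
  moreover have "1 / 2 ^ n \<le> (1 / 2 ^ m :: real) \<longleftrightarrow> (2 :: real) ^ m \<le> 2 ^ n" for m :: nat
    by (simp add: field_simps)
  ultimately have "1 / 2 ^ n \<le> tower U x \<longleftrightarrow> (2 :: real) ^ ?m \<le> 2 ^ n"
    by (simp only:)
  also have "\<dots> \<longleftrightarrow> ?m \<le> n" by simp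
  also have "\<dots> \<longleftrightarrow> (\<exists>i\<le>n. x \<notin> U i)"
  proof
    assume "?m \<le> n"
    moreover have "x \<notin> U ?m" using False LeastI_ex[of "\<lambda>n. x \<notin> U n"] by simp
    ultimately show "\<exists>i\<le>n. x \<notin> U i" by blast
  next
    assume "\<exists>i\<le>n. x \<notin> U i"
    then obtain i where "i \<le> n" "x \<notin> U i" by blast
    then show "?m \<le> n" by (meson Least_le le_trans)
  qed
  finally show ?thesis .
qed (simp add: tower_def not_le)

text \<open>Once \<open>1 / 2 ^ n < e\<close>, only the sets up to \<open>n\<close> matter. On the
  intersection \<open>V\<close> of those among them that contain \<open>x\<close>, a point whose
  first missed set has number at most \<open>n\<close> misses a set that \<open>x\<close> misses
  too.\<close>

lemma tower_usc:
  assumes "\<And>n. open (U n)" "0 < e"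
  obtains d where "0 < d" "\<And>y. \<bar>y - x\<bar> < d \<Longrightarrow> tower U y < tower U x + e"
proof -
  obtain n where n: "1 / 2 ^ n < e"
    using real_arch_pow_inv[of e "1 / 2"] assms(2) by (auto simp: power_one_over)
  define V where "V = (\<Inter>i\<in>{i. i \<le> n \<and> x \<in> U i}. U i)"
  have "open V" "x \<in> V" unfolding V_def using assms(1) by (auto intro!: open_INT)
  then obtain d where d: "0 < d" "ball x d \<subseteq> V" by (meson openE)
  have "tower U y < tower U x + e" if "\<bar>y - x\<bar> < d" for y
  proof (rule ccontr)
    assume contra: "\<not> tower U y < tower U x + e"
    then have "1 / 2 ^ n \<le> tower U y" using n tower_bounds(1)[of U x] by linarith
    then have ex: "\<exists>i. y \<notin> U i" by (auto simp: tower_ge_iff)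
    define i where "i = (LEAST i. y \<notin> U i)"
    have y: "tower U y = 1 / 2 ^ i" "y \<notin> U i"
      using ex LeastI_ex[OF ex] by (auto simp: tower_def i_def)
    have "i \<le> n"
      using \<open>1 / 2 ^ n \<le> tower U y\<close> unfolding y(1) by (simp add: field_simps)
    moreover have "y \<in> V" using that d by (auto simp: dist_real_def)
    ultimately have "x \<notin> U i" using y(2) by (auto simp: V_def)
    then have "tower U y \<le> tower U x" unfolding y(1) tower_ge_iff by blast
    with contra assms(2) show False by linarith
  qed
  with d(1) show ?thesis by (rule that)
qed

lemma dense_Int_finite:
  assumes "\<And>n. open (U n)" "\<And>n. closure (U n) = (UNIV :: real set)" "open W" "W \<noteq> {}"
  shows "\<exists>y\<in>W. \<forall>i\<le>n :: nat. y \<in> U i"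
  using assms(3,4)
proof (induction n arbitrary: W)
  case 0
  then have "W \<inter> U 0 \<noteq> {}" using assms(2) open_Int_closure_eq_empty[of W "U 0"] by auto
  then show ?case by auto
next
  case (Suc n)
  then have "W \<inter> U (Suc n) \<noteq> {}"
    using assms(2) open_Int_closure_eq_empty[of W "U (Suc n)"] by auto
  moreover have "open (W \<inter> U (Suc n))" using Suc.prems assms(1) by auto
  ultimately obtain y where "y \<in> W \<inter> U (Suc n)" "\<forall>i\<le>n. y \<in> U i" using Suc.IH by blast
  then show ?case by (auto simp: le_Suc_eq intro!: bexI[of _ y])
qed

lemma tower_small:
  assumes "\<And>n. open (U n)" "\<And>n. closure (U n) = UNIV" "open W" "W \<noteq> {}" "0 < e"
  shows "\<exists>y\<in>W. tower U y < e"
proof -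
  obtain n where n: "1 / 2 ^ n < e"
    using real_arch_pow_inv[of e "1 / 2"] assms(5) by (auto simp: power_one_over)
  obtain y where y: "y \<in> W" "\<forall>i\<le>n. y \<in> U i"
    using dense_Int_finite[of U W n, OF assms(1-4)] by blast
  then have "\<not> 1 / 2 ^ n \<le> tower U y" by (auto simp: tower_ge_iff)
  with y n show ?thesis by (intro bexI[of _ y]) auto
qed

text \<open>Density makes every local infimum 0, so the oscillation is the limit of the local
  suprema. These are at least the value at \<open>x\<close> and come down to it by upper
  semicontinuity.\<close>

lemma osc_tower:
  assumes "\<And>n. open (U n)" "\<And>n. closure (U n) = UNIV" "x \<in> {0..1}"
  shows "osc (tower U) x = ereal (tower U x)"
proof -
  define B where "B k = ball x (1 / 2 ^ k) \<inter> {0..1}" for k :: nat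
  have inf: "(INF y\<in>B k. ereal (tower U y)) = 0" for k
  proof (rule INF_eqI)
    show "0 \<le> ereal (tower U y)" for y by (simp add: tower_bounds)
    fix z assume z: "\<And>y. y \<in> B k \<Longrightarrow> z \<le> ereal (tower U y)"
    show "z \<le> 0"
    proof (rule ccontr)
      assume "\<not> z \<le> 0"
      then obtain e where e: "0 < ereal e" "ereal e < z" using ereal_dense2[of 0 z] by (auto simp: not_le)
      \<comment> \<open>At an endpoint the ball within the unit interval is not open in the line;
        its intersection with the open interval is, and is still non-empty.\<close>
      have "x \<in> ball x (1 / 2 ^ k) \<inter> closure {0<..<1}" using assms(3) by simp
      then have "ball x (1 / 2 ^ k) \<inter> {0<..<1} \<noteq> {}"
        using open_Int_closure_eq_empty[of "ball x (1 / 2 ^ k)" "{0<..<1::real}"] by blast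
      then have "\<exists>y\<in>ball x (1 / 2 ^ k) \<inter> {0<..<1}. tower U y < e"
        using tower_small[of U "ball x (1 / 2 ^ k) \<inter> {0<..<1}" e, OF assms(1,2)] e(1)
        by (simp add: open_Int)
      then obtain y where "y \<in> ball x (1 / 2 ^ k) \<inter> {0<..<1}" "tower U y < e" by blast
      then have "z \<le> ereal (tower U y)" "ereal (tower U y) < ereal e"
        by (auto simp: B_def intro!: z)
      with e(2) show False by (meson leD less_trans)
    qed
  qed
  have "(\<lambda>k. osc_on (tower U) (B k)) \<longlonglongrightarrow> ereal (tower U x)"
  proof (rule order_tendstoI)
    fix a assume "a < ereal (tower U x)"
    moreover have "ereal (tower U x) \<le> (SUP y\<in>B k. ereal (tower U y))" for k
      using assms(3) by (intro SUP_upper) (auto simp: B_def)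
    ultimately show "\<forall>\<^sub>F k in sequentially. a < osc_on (tower U) (B k)"
      unfolding osc_on_def inf by (simp add: less_le_trans)
  next
    fix a assume "ereal (tower U x) < a"
    then obtain b where b: "tower U x < b" "ereal b < a"
      using ereal_dense2[of "ereal (tower U x)" a] by auto
    obtain d where d: "0 < d" "\<And>y. \<bar>y - x\<bar> < d \<Longrightarrow> tower U y < tower U x + (b - tower U x)"
      using tower_usc[of U "b - tower U x" x, OF assms(1)] b(1) by (metis diff_gt_0_iff_gt)
    obtain n where n: "1 / 2 ^ n < d"
      using real_arch_pow_inv[of d "1 / 2"] d(1) by (auto simp: power_one_over)
    have "osc_on (tower U) (B k) < a" if "n \<le> k" for k
    proof -
      have kn: "1 / 2 ^ k \<le> (1 / 2 ^ n :: real)" using that by (simp add: field_simps)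
      have "(SUP y\<in>B k. ereal (tower U y)) \<le> ereal b"
      proof (rule SUP_least)
        fix y assume "y \<in> B k"
        then have "\<bar>y - x\<bar> < d"
          using n kn by (simp add: B_def dist_real_def abs_minus_commute)
        from d(2)[OF this] show "ereal (tower U y) \<le> ereal b" by simp
      qed
      with b(2) show ?thesis unfolding osc_on_def inf by (simp add: le_less_trans)
    qed
    then show "\<forall>\<^sub>F k in sequentially. osc_on (tower U) (B k) < a"
      unfolding eventually_sequentially by blast
  qed
  then show ?thesis unfolding osc_def B_def by (rule limI)
qed

lemma osc_ge_tower:
  assumes "\<And>n. open (U n)" "\<And>n. closure (U n) = UNIV"
  shows "{0..1} - osc_ge (tower U) n = {x \<in> {0..1}. \<forall>i\<le>n. x \<in> U i}"
proof -
  have "ereal (1 / 2 ^ n) \<le> osc (tower U) x \<longleftrightarrow> (\<exists>i\<le>n. x \<notin> U i)" if "x \<in> {0..1}" for x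
    unfolding osc_tower[of U x, OF assms that] ereal_less_eq(3) by (rule tower_ge_iff)
  then show ?thesis by (fastforce simp: osc_ge_def)
qed

text \<open>Sup-convolutions with steeper and steeper cones decrease to the upper semicontinuous tower.\<close>

lemma baire1_tower:
  assumes "\<And>n. open (U n)"
  shows "baire1 (tower U)"
proof -
  let ?f = "tower U"
  define g where "g m x = (SUP y\<in>{0..1}. ?f y - real m * \<bar>x - y\<bar>)" for m x
  have bdd: "bdd_above ((\<lambda>y. ?f y - real m * \<bar>x - y\<bar>) ` A)" for m x A
  proof (rule bdd_aboveI2)
    show "?f y - real m * \<bar>x - y\<bar> \<le> 1" for y
      using tower_bounds(2)[of U y] mult_nonneg_nonneg[of "real m" "\<bar>x - y\<bar>"] by linarith
  qed
  have lip: "g m x \<le> g m x' + real m * \<bar>x - x'\<bar>" for m x x'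
    unfolding g_def
  proof (rule cSUP_least)
    fix y :: real assume y: "y \<in> {0..1}"
    have "real m * \<bar>x' - y\<bar> \<le> real m * (\<bar>x - y\<bar> + \<bar>x - x'\<bar>)"
      by (rule mult_left_mono) linarith+
    then have "real m * \<bar>x' - y\<bar> \<le> real m * \<bar>x - y\<bar> + real m * \<bar>x - x'\<bar>"
      by (simp only: distrib_left)
    moreover have "?f y - real m * \<bar>x' - y\<bar> \<le> (SUP y\<in>{0..1}. ?f y - real m * \<bar>x' - y\<bar>)"
      by (rule cSUP_upper[OF y bdd])
    ultimately show "?f y - real m * \<bar>x - y\<bar> \<le> (SUP y\<in>{0..1}. ?f y - real m * \<bar>x' - y\<bar>) + real m * \<bar>x - x'\<bar>"
      by linarith
  qed auto
  have "continuous_on {0..1} (g m)" for m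
  proof (rule continuous_on_subset[OF lipschitz_on_continuous_on])
    show "(real m)-lipschitz_on UNIV (g m)"
    proof (rule lipschitz_onI)
      show "dist (g m x) (g m y) \<le> real m * dist x y" for x y
        using lip[of m x y] lip[of m y x] unfolding dist_real_def abs_minus_commute[of y x]
        by linarith
    qed simp
  qed auto
  moreover have "(\<lambda>m. g m x) \<longlonglongrightarrow> ?f x" if x: "x \<in> {0..1}" for x
  proof (rule LIMSEQ_I)
    fix e :: real assume "0 < e"
    then have "0 < e / 2" by simp
    then obtain d where d: "0 < d" "\<And>y. \<bar>y - x\<bar> < d \<Longrightarrow> ?f y < ?f x + e / 2"
      using tower_usc[of U "e / 2" x, OF assms] by blast
    \<comment> \<open>From slope \<open>1 / d\<close> on, a cone falls by at least 1 at distance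
      \<open>d\<close>, which outweighs any value of the tower there.\<close>
    obtain N where N: "1 / d < real N" using reals_Archimedean2 by blast
    have "norm (g m x - ?f x) < e" if "N \<le> m" for m
    proof -
      have "?f x \<le> g m x"
        using cSUP_upper[OF x bdd[of m x "{0..1}"]] by (simp add: g_def)
      moreover have "g m x \<le> ?f x + e / 2"
        unfolding g_def
      proof (rule cSUP_least)
        fix y :: real
        show "?f y - real m * \<bar>x - y\<bar> \<le> ?f x + e / 2"
        proof (cases "\<bar>y - x\<bar> < d")
          case True
          have "0 \<le> real m * \<bar>x - y\<bar>" by simp
          with d(2)[OF True] show ?thesis by linarith
        next
          case False
          have "1 / d * d \<le> real m * \<bar>x - y\<bar>"
            using N that False d(1) by (intro mult_mono) auto
          then have "1 \<le> real m * \<bar>x - y\<bar>" using d(1) by simp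
          with tower_bounds(2)[of U y] tower_bounds(1)[of U x] \<open>0 < e\<close> show ?thesis by linarith
        qed
      qed auto
      ultimately show ?thesis using \<open>0 < e\<close> by simp
    qed
    then show "\<exists>N. \<forall>m\<ge>N. norm (g m x - ?f x) < e" by blast
  qed
  ultimately show ?thesis unfolding baire1_def by blast
qed

section \<open>Application of the two functionals\<close>

text \<open>The values of the tower are rational, so constant sequences code them. The condition
  \<open>S n \<alpha> = 0\<close> says that the real coded by \<open>\<alpha>\<close> is outside the
  \<open>n\<close>-th set.\<close>

definition tcode :: "(nat \<Rightarrow> type2) \<Rightarrow> type1 \<Rightarrow> type1" where
  "tcode S \<alpha> k = (if \<exists>n. S n \<alpha> = 0 then rhalf (LEAST n. S n \<alpha> = 0) else rcode 0 0 1)"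

lemma codes_tcode:
  assumes "\<And>n. S n \<alpha> = (if x \<in> U n then 1 else 0)"
  shows "codes (tcode S \<alpha>) (tower U x)"
proof -
  have "tcode S \<alpha> = (\<lambda>_. if \<forall>n. x \<in> U n then rcode 0 0 1 else rhalf (LEAST n. x \<notin> U n))"
    by (rule ext) (simp add: tcode_def assms)
  moreover have "tower U x = rv (if \<forall>n. x \<in> U n then rcode 0 0 1 else rhalf (LEAST n. x \<notin> U n))"
    by (simp add: tower_def rv_rcode rv_rhalf)
  ultimately show ?thesis by (simp only: codes_const)
qed

text \<open>The tower is its own oscillation function, so \<open>tcode S\<close> is a correct code
  for both function inputs of \<open>\<Theta>\<close>.\<close>

lemma osc_functional_tower:
  assumes "is_osc_functional \<Theta>" "\<And>n. open (U n)" "\<And>n. closure (U n) = UNIV"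
    and S: "\<And>n \<alpha> x. codes \<alpha> x \<Longrightarrow> S n \<alpha> = (if x \<in> U n then 1 else 0)"
  obtains Y where "R2 Y {x \<in> {0..1}. \<forall>i\<le>n. x \<in> U i}" "codes_pfun (\<Theta> (tcode S) (tcode S) n) Y"
proof -
  have "codes_fun (tcode S) (tower U)"
    unfolding codes_fun_def by (intro allI ballI impI codes_tcode S)
  moreover have "baire1 (tower U)" by (rule baire1_tower[of U, OF assms(2)])
  moreover have "\<forall>x\<in>{0..1}. osc (tower U) x = ereal (tower U x)"
    by (intro ballI osc_tower[of U] assms(2,3))
  ultimately have "\<exists>Y. R2 Y ({0..1} - osc_ge (tower U) n) \<and> codes_pfun (\<Theta> (tcode S) (tcode S) n) Y"
    using assms(1) unfolding is_osc_functional_def by blast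
  then show ?thesis
    unfolding osc_ge_tower[of U, OF assms(2,3)] using that by blast
qed

lemma computes_num_sub: "computes (num_ctx E) g \<Longrightarrow> computes (num_ctx (sub_ctx E P)) g"
  unfolding computes_def num_ctx_def sub_ctx_def by blast

lemma computes_fun_app:
  "good_ctx E \<Longrightarrow> computes (fun_ctx E) a \<Longrightarrow> computes (fun_ctx E) (\<lambda>z. fst z (a z))"
  by (rule computes1_app[OF computes1_fun_var])

text \<open>When a contracted functional queries a function component, entry 0 of the query is the
  number of the component and entry 1 the place of the output; the queried code starts at entry
  2.\<close>

lemma computes1_fun_shift:
  assumes "good_ctx E"
  shows "computes1 (fun_ctx E) (\<lambda>z i. fst z (Suc (Suc i)))"
  unfolding computes1_def
  by (rule computes1_app[OF computes1_weaken_num[OF good_fun computes1_fun_var]])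
    (intro assms computes_Suc computes_num_var)+

lemma computes_total2:
  assumes "good_ctx E" "has2 E (\<lambda>x f. Some (S x f))" "computes1 E \<alpha>"
  shows "computes E (\<lambda>x. S x (\<alpha> x))"
  by (rule computes_app2[OF assms(1,2) assms(3)[unfolded computes1_def]]) simp

lemma computes_seq_obj:
  assumes "good_ctx E" "has2 E (\<lambda>x \<beta>. Some (S x (\<beta> 0) (\<lambda>i. \<beta> (Suc i))))" "computes E n" "computes1 E \<alpha>"
  shows "computes E (\<lambda>x. S x (n x) (\<alpha> x))"
proof (rule computes_app2[OF assms(1,2), where h = "\<lambda>k x. if k = 0 then n x else \<alpha> x (k - 1)"])
  show "computes (num_ctx E) (\<lambda>z. if fst z = 0 then n (snd z) else \<alpha> (snd z) (fst z - 1))"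
    by (rule computes_if; (rule computes1_app[OF computes1_weaken_num[OF assms(1,4)]])?)
      (intro computes_intros assms)+
qed simp

text \<open>The search for the least \<open>n\<close> starts only after \<open>exists2\<close> has
  confirmed that it will succeed.\<close>

lemma computes_tcode:
  assumes "good_ctx E" "computes (num_ctx E) (\<lambda>z. S (snd z) (fst z) (\<alpha> (snd z)))"
  shows "computes E (\<lambda>x. tcode (S x) (\<alpha> x) (k x))"
  unfolding tcode_def
proof (rule computes_if_lazy)
  show "dec E (\<lambda>x. \<exists>n. S x n (\<alpha> x) = 0)"
    by (intro dec_ex dec_eq computes_const good_num assms)
  let ?E = "sub_ctx E (\<lambda>x. \<exists>n. S x n (\<alpha> x) = 0)"
  show "computes ?E (\<lambda>x. rhalf (LEAST n. S x n (\<alpha> x) = 0))"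
  proof (rule computes_rhalf[OF good_sub[OF assms(1)] computes_Least])
    show "dec (num_ctx ?E) (\<lambda>z. S (snd z) (fst z) (\<alpha> (snd z)) = 0)"
      by (intro dec_eq computes_const computes_num_sub good_num good_sub assms)
  qed (use assms(1) in \<open>auto simp: sub_ctx_def\<close>)
qed (intro assms computes_const)+

text \<open>The map inside \<open>osc_functional_obj\<close>, without the constructor, as
  \<open>has3\<close> takes it.\<close>

definition osc_contraction :: "osc_functional \<Rightarrow> type2 \<Rightarrow> nat option" where
  "osc_contraction \<Theta> G = \<Theta> (fun_comp 0 G) (fun_comp 1 G) (nat_comp 2 G) (seq_comp 3 G) (nat_comp 4 G)"

lemma computes_osc_functional:
  assumes "good_ctx E" "has3 E (\<lambda>x. osc_contraction (\<Theta> x))"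
    and S: "computes (num_ctx (fun_ctx E)) (\<lambda>z. S (snd (snd z)) (fst z) (\<lambda>i. fst (snd z) (Suc (Suc i))))"
    and "computes E n" "computes1 E \<alpha>" "computes E k"
    and def: "\<And>x \<Phi>. E x \<Phi> \<Longrightarrow> \<Theta> x (tcode (S x)) (tcode (S x)) (n x) (\<alpha> x) (k x) \<noteq> None"
  shows "computes E (\<lambda>x. the (\<Theta> x (tcode (S x)) (tcode (S x)) (n x) (\<alpha> x) (k x)))"
\<comment> \<open>S8 needs a total argument, so the last component also answers queries with numbers
  beyond 4. Components 0 and 1 share one branch because both function inputs are
  \<open>tcode\<close>.\<close>
proof (rule computes_app3[OF assms(1,2), where G = "\<lambda>f x.
    if f 0 \<le> 1 then tcode (S x) (\<lambda>i. f (Suc (Suc i))) (f 1)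
    else if f 0 = 2 then n x else if f 0 = 3 then \<alpha> x (f 1) else k x"])
  show "computes (fun_ctx E) (\<lambda>z. if fst z 0 \<le> 1 then tcode (S (snd z)) (\<lambda>i. fst z (Suc (Suc i))) (fst z 1)
      else if fst z 0 = 2 then n (snd z) else if fst z 0 = 3 then \<alpha> (snd z) (fst z 1) else k (snd z))"
    by (intro computes_if dec_le dec_eq computes_const computes_fun_app computes_tcode good_fun
        computes1_app[OF computes1_weaken_fun[OF assms(1,5)]] computes_weaken_fun assms)
  fix x \<Phi> assume "E x \<Phi>"
  let ?G = "\<lambda>f. if f 0 \<le> 1 then tcode (S x) (\<lambda>i. f (Suc (Suc i))) (f 1)
    else if f 0 = 2 then n x else if f 0 = 3 then \<alpha> x (f 1) else k x"
  have "fun_comp 0 ?G = tcode (S x)" "fun_comp 1 ?G = tcode (S x)"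
    "nat_comp 2 ?G = n x" "seq_comp 3 ?G = \<alpha> x" "nat_comp 4 ?G = k x"
    by (auto simp: fun_comp_def nat_comp_def seq_comp_def fun_eq_iff)
  with def[OF \<open>E x \<Phi>\<close>]
  show "osc_contraction (\<Theta> x) ?G = Some (the (\<Theta> x (tcode (S x)) (tcode (S x)) (n x) (\<alpha> x) (k x)))"
    by (simp only: osc_contraction_def option.collapse not_None_eq)
qed

definition conv_contraction :: "conv_functional \<Rightarrow> type2 \<Rightarrow> nat option" where
  "conv_contraction \<Delta> G = \<Delta> (fun_comp 0 G) (seq_comp 1 G) (nat_comp 2 G)"

lemma computes_conv_functional:
  assumes "good_ctx E" "has3 E (\<lambda>x. conv_contraction (\<Delta> x))"
    and F: "computes (fun_ctx E) (\<lambda>z. F (snd z) (\<lambda>i. fst z (Suc (Suc i))) (fst z 1))"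
    and "computes1 E \<alpha>" "computes E k"
    and def: "\<And>x \<Phi>. E x \<Phi> \<Longrightarrow> \<Delta> x (F x) (\<alpha> x) (k x) \<noteq> None"
  shows "computes E (\<lambda>x. the (\<Delta> x (F x) (\<alpha> x) (k x)))"
proof (rule computes_app3[OF assms(1,2), where G = "\<lambda>f x.
    if f 0 = 0 then F x (\<lambda>i. f (Suc (Suc i))) (f 1) else if f 0 = 1 then \<alpha> x (f 1) else k x"])
  show "computes (fun_ctx E) (\<lambda>z. if fst z 0 = 0 then F (snd z) (\<lambda>i. fst z (Suc (Suc i))) (fst z 1)
      else if fst z 0 = 1 then \<alpha> (snd z) (fst z 1) else k (snd z))"
    by (intro computes_if dec_eq computes_const computes_fun_app good_fun
        computes1_app[OF computes1_weaken_fun[OF assms(1,4)]] computes_weaken_fun assms)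
  fix x \<Phi> assume "E x \<Phi>"
  let ?G = "\<lambda>f. if f 0 = 0 then F x (\<lambda>i. f (Suc (Suc i))) (f 1) else if f 0 = 1 then \<alpha> x (f 1) else k x"
  have "fun_comp 0 ?G = F x" "seq_comp 1 ?G = \<alpha> x" "nat_comp 2 ?G = k x"
    by (auto simp: fun_comp_def nat_comp_def seq_comp_def fun_eq_iff)
  with def[OF \<open>E x \<Phi>\<close>] show "conv_contraction (\<Delta> x) ?G = Some (the (\<Delta> x (F x) (\<alpha> x) (k x)))"
    by (simp only: conv_contraction_def option.collapse not_None_eq)
qed

section \<open>The Baire realiser\<close>

definition unit_rat :: "nat \<Rightarrow> bool" where
  "unit_rat c \<longleftrightarrow> rv (rcode 0 0 1) \<le> rv c \<and> rv c \<le> rv (rcode 1 0 1)"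

text \<open>\<open>\<Theta>\<close> is queried at rational points, with the constant sequence as
  their code.\<close>

definition distance_code :: "(nat \<Rightarrow> type2) \<Rightarrow> osc_functional \<Rightarrow> nat \<Rightarrow> nat \<Rightarrow> nat \<Rightarrow> nat" where
  "distance_code S \<Theta> n c k = the (\<Theta> (tcode S) (tcode S) n (\<lambda>_. c) k)"

text \<open>
  A number \<open>prod_encode (c, e)\<close> stands for the interval with centre \<open>rv c\<close> and radius \<open>1 / 2 ^ e\<close>.
  The last conjunct makes the value of the (R.2)-representation at the new centre exceed the new
  radius, since the approximation at index \<open>e'\<close> has error at most \<open>1 / 2 ^ e'\<close>.
\<close>

definition refines :: "(nat \<Rightarrow> type2) \<Rightarrow> osc_functional \<Rightarrow> nat \<Rightarrow> nat \<Rightarrow> nat \<Rightarrow> bool" where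
  "refines S \<Theta> n s s' \<longleftrightarrow>
     (let c = fst (prod_decode s); e = snd (prod_decode s);
          c' = fst (prod_decode s'); e' = snd (prod_decode s')
      in unit_rat c' \<and> e < e' \<and> rv (radd c (rhalf e')) \<le> rv (radd c' (rhalf e)) \<and>
         rv (radd c' (rhalf e')) \<le> rv (radd c (rhalf e)) \<and>
         rv (radd (rhalf e') (rhalf e')) < rv (distance_code S \<Theta> n c' e'))"

text \<open>The start is the interval with centre 0 and radius 1. The second disjunct makes the
  search end for every number \<open>s\<close>, since the step of a recursion has to be computable
  at all previous values and not only at those that occur.\<close>

definition interval_seq :: "(nat \<Rightarrow> type2) \<Rightarrow> osc_functional \<Rightarrow> nat \<Rightarrow> nat" where
  "interval_seq S \<Theta> = rec_nat (prod_encode (rcode 0 0 1, 0))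
     (\<lambda>n s. LEAST s'. refines S \<Theta> n s s' \<or> \<not> unit_rat (fst (prod_decode s)))"

definition baire_valid :: "(nat \<Rightarrow> type2) \<Rightarrow> (nat \<Rightarrow> real set) \<Rightarrow> osc_functional \<Rightarrow> bool" where
  "baire_valid S U \<Theta> \<longleftrightarrow> is_osc_functional \<Theta> \<and>
     (\<forall>n. open (U n) \<and> closure (U n) = UNIV \<and> codes_set (S n) (U n))"

lemma unit_rat_iff: "unit_rat c \<longleftrightarrow> rv c \<in> {0..1}"
  by (simp add: unit_rat_def rv_rcode)

lemma baire_valid_R2:
  assumes "baire_valid S U \<Theta>"
  obtains Y where "R2 Y {x \<in> {0..1}. \<forall>i\<le>n. x \<in> U i}" "codes_pfun (\<Theta> (tcode S) (tcode S) n) Y"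
proof (rule osc_functional_tower[of \<Theta> U S n])
  show "S n \<alpha> = (if x \<in> U n then 1 else 0)" if "codes \<alpha> x" for n \<alpha> x
    using assms that unfolding baire_valid_def codes_set_def by blast
qed (use assms that in \<open>auto simp: baire_valid_def\<close>)

lemma distance_code:
  assumes "codes_pfun (\<Theta> (tcode S) (tcode S) n) Y" "unit_rat c"
  shows "codes (distance_code S \<Theta> n c) (Y (rv c))"
proof -
  obtain \<beta> where \<beta>: "\<And>k. \<Theta> (tcode S) (tcode S) n (\<lambda>_. c) k = Some (\<beta> k)" "codes \<beta> (Y (rv c))"
    using assms codes_const[of c] unfolding codes_pfun_def unit_rat_iff by blast
  then have "distance_code S \<Theta> n c = \<beta>" by (auto simp: distance_code_def)
  with \<beta>(2) show ?thesis by simp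
qed

lemma baire_valid_defined:
  assumes "baire_valid S U \<Theta>" "unit_rat c"
  shows "\<Theta> (tcode S) (tcode S) n (\<lambda>_. c) k \<noteq> None"
proof -
  obtain Y where "codes_pfun (\<Theta> (tcode S) (tcode S) n) Y"
    using baire_valid_R2[OF assms(1)] by blast
  then show ?thesis
    using assms(2) codes_const[of c] unfolding codes_pfun_def unit_rat_iff by (metis option.distinct(1))
qed

text \<open>By density the interval meets the first \<open>n + 1\<close> sets in a common point, and
  by openness in a rational one, where the representation is positive. Any small enough radius then
  works.\<close>

lemma exists_refines:
  assumes "baire_valid S U \<Theta>" "unit_rat (fst (prod_decode s))"
  shows "\<exists>s'. refines S \<Theta> n s s'"
proof -
  define c e where "c = fst (prod_decode s)" and "e = snd (prod_decode s)"
  obtain Y where Y: "R2 Y {x \<in> {0..1}. \<forall>i\<le>n. x \<in> U i}" "codes_pfun (\<Theta> (tcode S) (tcode S) n) Y"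
    using baire_valid_R2[OF assms(1)] by blast
  have U: "\<And>n. open (U n)" "\<And>n. closure (U n) = UNIV"
    using assms(1) by (auto simp: baire_valid_def)
  \<comment> \<open>The open unit interval keeps the new centre inside the domain even if the old
    one is an endpoint.\<close>
  let ?W = "ball (rv c) (1 / 2 ^ e) \<inter> {0<..<1}"
  have "rv c \<in> ball (rv c) (1 / 2 ^ e) \<inter> closure {0<..<1}"
    using assms(2) by (simp add: c_def unit_rat_iff)
  then have "?W \<noteq> {}"
    using open_Int_closure_eq_empty[of "ball (rv c) (1 / 2 ^ e)" "{0<..<1::real}"] by blast
  then obtain y where y: "y \<in> ?W" "\<forall>i\<le>n. y \<in> U i"
    using dense_Int_finite[of U ?W n, OF U] by (metis open_Int open_ball open_greaterThanLessThan)
  define V where "V = ?W \<inter> (\<Inter>i\<in>{..n}. U i)"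
  have "open V"
    unfolding V_def by (intro open_Int open_ball open_greaterThanLessThan open_INT ballI U(1)) simp
  moreover have "y \<in> V" using y by (simp add: V_def)
  ultimately obtain d where d: "0 < d" "ball y d \<subseteq> V" by (meson openE)
  obtain q where q: "q \<in> \<rat>" "y < q" "q < y + d" using Rats_dense_in_real[of y "y + d"] d(1) by auto
  obtain c' where c': "rv c' = q" using rv_surj[OF q(1)] by blast
  have "q \<in> V" using d(2) q by (auto simp: dist_real_def)
  then have q': "\<bar>q - rv c\<bar> < 1 / 2 ^ e" "0 < q" "q < 1" "\<forall>i\<le>n. q \<in> U i"
    by (auto simp: V_def dist_real_def abs_minus_commute)
  then have "0 < Y q" using Y(1) unfolding R2_def by auto
  \<comment> \<open>The first bound makes \<open>Y q\<close> exceed three new radii: two for the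
    test in \<open>refines\<close> and one for the error of the approximation. The second keeps the
    new interval within the old one.\<close>
  define r where "r = min (Y q / 3) (1 / 2 ^ e - \<bar>q - rv c\<bar>)"
  have "0 < r" using q' \<open>0 < Y q\<close> by (simp add: r_def)
  then obtain N where N: "1 / 2 ^ N < r"
    using real_arch_pow_inv[of r "1 / 2"] by (auto simp: power_one_over)
  \<comment> \<open>Larger than \<open>e\<close>, as \<open>refines\<close> asks, and at least
    \<open>N\<close>.\<close>
  define e' where "e' = Suc (e + N)"
  have "1 / 2 ^ e' \<le> (1 / 2 ^ N :: real)"
    unfolding e'_def by (intro divide_left_mono power_increasing) auto
  with N have e': "1 / 2 ^ e' < Y q / 3" "1 / 2 ^ e' < 1 / 2 ^ e - \<bar>q - rv c\<bar>"
    by (auto simp: r_def)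
  have "unit_rat c'" using c' q' by (simp add: unit_rat_iff)
  then have "codes (distance_code S \<Theta> n c') (Y q)"
    using distance_code[of \<Theta> S n Y c', OF Y(2)] c' by simp
  from codes_approx[OF this, of e'] have "1 / 2 ^ e' + 1 / 2 ^ e' < rv (distance_code S \<Theta> n c' e')"
    using e'(1) by linarith
  moreover have "rv c + 1 / 2 ^ e' \<le> q + 1 / 2 ^ e" "q + 1 / 2 ^ e' \<le> rv c + 1 / 2 ^ e"
    using e'(2) by linarith+
  moreover have "e < e'" by (simp add: e'_def)
  ultimately have "refines S \<Theta> n s (prod_encode (c', e'))"
    using \<open>unit_rat c'\<close>
    by (simp add: refines_def rv_radd rv_rhalf c' flip: c_def e_def)
  then show ?thesis by blast
qed

lemma interval_seq_0: "interval_seq S \<Theta> 0 = prod_encode (rcode 0 0 1, 0)"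
  by (simp add: interval_seq_def)

lemma interval_seq_Suc: "interval_seq S \<Theta> (Suc n) = (LEAST s'. refines S \<Theta> n (interval_seq S \<Theta> n) s' \<or>
    \<not> unit_rat (fst (prod_decode (interval_seq S \<Theta> n))))"
  by (simp add: interval_seq_def)

text \<open>The start has its centre in the unit interval and refinement preserves this, so the
  escape disjunct of the search is false throughout.\<close>

lemma interval_seq_refines:
  assumes "baire_valid S U \<Theta>"
  shows "refines S \<Theta> n (interval_seq S \<Theta> n) (interval_seq S \<Theta> (Suc n))"
    and "unit_rat (fst (prod_decode (interval_seq S \<Theta> n)))"
proof -
  have step: "refines S \<Theta> n (interval_seq S \<Theta> n) (interval_seq S \<Theta> (Suc n))"
    if "unit_rat (fst (prod_decode (interval_seq S \<Theta> n)))" for n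
    using LeastI_ex[OF exists_refines[OF assms that, of n]] that by (simp add: interval_seq_Suc)
  have unit: "unit_rat (fst (prod_decode (interval_seq S \<Theta> n)))" for n
  proof (induction n)
    case 0
    show ?case by (simp add: interval_seq_0 unit_rat_iff rv_rcode)
  next
    case (Suc n)
    from step[OF this] show ?case by (simp add: refines_def Let_def)
  qed
  then show "unit_rat (fst (prod_decode (interval_seq S \<Theta> n)))" .
  from step[OF unit] show "refines S \<Theta> n (interval_seq S \<Theta> n) (interval_seq S \<Theta> (Suc n))" .
qed

text \<open>The limit lies within one radius of every centre, and at the centre the representation
  exceeds the radius, so (R.2) places the limit in the represented set.\<close>

lemma interval_seq_limit:
  assumes "baire_valid S U \<Theta>"
  shows "\<exists>x. codes (\<lambda>n. fst (prod_decode (interval_seq S \<Theta> n))) x \<and> x \<in> (\<Inter>n. U n)"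
proof -
  define c e where "c n = fst (prod_decode (interval_seq S \<Theta> n))"
    and "e n = snd (prod_decode (interval_seq S \<Theta> n))" for n
  have e: "e n < e (Suc n)"
    and near: "rv (c n) + 1 / 2 ^ e (Suc n) \<le> rv (c (Suc n)) + 1 / 2 ^ e n"
      "rv (c (Suc n)) + 1 / 2 ^ e (Suc n) \<le> rv (c n) + 1 / 2 ^ e n"
    and far: "1 / 2 ^ e (Suc n) + 1 / 2 ^ e (Suc n) < rv (distance_code S \<Theta> n (c (Suc n)) (e (Suc n)))"
    for n
    using interval_seq_refines(1)[OF assms, of n]
    by (simp_all add: refines_def Let_def rv_radd rv_rhalf c_def e_def)
  have unit: "rv (c n) \<in> {0..1}" for n
    using interval_seq_refines(2)[OF assms, of n] by (simp add: unit_rat_iff c_def)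
  \<comment> \<open>The inequalities \<open>near\<close> bound the distance of consecutive centres
    by the difference of the radii, and these bounds telescope.\<close>
  have nest: "\<bar>rv (c n) - rv (c (n + i))\<bar> + 1 / 2 ^ e (n + i) \<le> 1 / 2 ^ e n" for n i
  proof (induction i)
    case (Suc i)
    with near[of "n + i"] show ?case by simp
  qed simp
  \<comment> \<open>The exponents increase strictly, so the radii shrink at the rate required of a
    code.\<close>
  have "n \<le> e n" for n
    by (induction n) (use e Suc_le_eq le_less_trans in blast)+
  then have "1 / 2 ^ e n \<le> (1 / 2 ^ n :: real)" for n
    by (simp add: field_simps)
  moreover have "(0 :: real) < 1 / 2 ^ e n" for n by simp
  ultimately have fast: "\<bar>rv (c n) - rv (c (n + i))\<bar> < 1 / 2 ^ n" for n i
    using nest[of n i] by (smt (verit, best))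
  \<comment> \<open>This test provides the limit and its membership in the unit interval
    together.\<close>
  have "unit_code c"
    unfolding unit_code_def
  proof (intro conjI allI)
    fix n i
    show "rv (c n) < rv (radd (c (n + i)) (rhalf n))" "rv (c (n + i)) < rv (radd (c n) (rhalf n))"
      using fast[of n i] by (auto simp: rv_radd rv_rhalf abs_less_iff)
  next
    fix n
    have "(0 :: real) < 1 / 2 ^ n" "0 \<le> rv (c n)" "rv (c n) \<le> 1" using unit[of n] by auto
    moreover have "rv (rcode 0 0 1) = 0" "rv (rcode 1 0 1) = 1" by (simp_all add: rv_rcode)
    ultimately show "rv (rcode 0 0 1) \<le> rv (radd (c n) (rhalf n))"
      "rv (c n) \<le> rv (radd (rcode 1 0 1) (rhalf n))"
      unfolding rv_radd rv_rhalf by linarith+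
  qed
  then obtain x where x: "x \<in> {0..1}" "codes c x" unfolding unit_code_iff by blast
  have close: "\<bar>rv (c n) - x\<bar> \<le> 1 / 2 ^ e n" for n
  proof -
    have "(\<lambda>i. rv (c (n + i))) \<longlonglongrightarrow> x"
      using x(2) LIMSEQ_ignore_initial_segment[of "\<lambda>n. rv (c n)" x n] by (simp add: codes_iff add.commute)
    then have "(\<lambda>i. \<bar>rv (c n) - rv (c (n + i))\<bar>) \<longlonglongrightarrow> \<bar>rv (c n) - x\<bar>"
      by (intro tendsto_intros)
    moreover have "\<bar>rv (c n) - rv (c (n + i))\<bar> \<le> 1 / 2 ^ e n" for i
    proof -
      have "(0 :: real) < 1 / 2 ^ e (n + i)" by simp
      with nest[of n i] show ?thesis by linarith
    qed
    ultimately show ?thesis by (intro LIMSEQ_le_const2) auto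
  qed
  have "x \<in> U n" for n
  proof -
    obtain Y where Y: "R2 Y {x \<in> {0..1}. \<forall>i\<le>n. x \<in> U i}" "codes_pfun (\<Theta> (tcode S) (tcode S) n) Y"
      using baire_valid_R2[OF assms] by blast
    \<comment> \<open>The interval with number \<open>n + 1\<close> is the one certified by the
      \<open>n\<close>-th representation.\<close>
    let ?c = "c (Suc n)" and ?e = "e (Suc n)"
    have "codes (distance_code S \<Theta> n ?c) (Y (rv ?c))"
      using unit by (intro distance_code Y(2)) (simp add: unit_rat_iff)
    from codes_approx[OF this, of ?e] far[of n] have "1 / 2 ^ ?e < Y (rv ?c)" by linarith
    moreover have "(0 :: real) < 1 / 2 ^ ?e" by simp
    ultimately have "0 < Y (rv ?c)" "x \<in> {rv ?c - Y (rv ?c)<..<rv ?c + Y (rv ?c)} \<inter> {0..1}"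
      using close[of "Suc n"] x(1) by (auto simp: abs_le_iff)
    then show ?thesis using Y(1) unit[of "Suc n"] unfolding R2_def by blast
  qed
  with x(2) show ?thesis unfolding c_def by blast
qed

section \<open>Computability of the interval sequence\<close>

lemma dec_unit_rat: "good_ctx E \<Longrightarrow> computes E c \<Longrightarrow> dec E (\<lambda>x. unit_rat (c x))"
  unfolding unit_rat_def by (intro dec_conj dec_rv_le computes_const)

text \<open>Validity of the inputs is part of the context, so that searches terminate and
  \<open>\<Theta>\<close> is defined wherever it is queried.\<close>

definition baire_ctx :: "((nat \<Rightarrow> type2) \<times> osc_functional) ctx" where
  "baire_ctx x \<Phi> \<longleftrightarrow> \<Phi> = [seq_obj (fst x), osc_functional_obj (snd x), total2 exists2] \<and>
     (\<exists>U. baire_valid (fst x) U (snd x))"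

lemma good_baire_ctx: "good_ctx baire_ctx"
  unfolding good_ctx_def ctx_length_def has2_def
  by (auto simp: baire_ctx_def total2_def intro!: exI[of _ 2])

lemma has2_baire_ctx: "has2 baire_ctx (\<lambda>x \<beta>. Some (fst x (\<beta> 0) (\<lambda>i. \<beta> (Suc i))))"
  unfolding has2_def by (auto simp: baire_ctx_def seq_obj_def total2_def intro!: exI[of _ 0])

lemma has3_baire_ctx: "has3 baire_ctx (\<lambda>x. osc_contraction (snd x))"
  unfolding has3_def
  by (auto simp: baire_ctx_def osc_functional_obj_def osc_contraction_def[abs_def] intro!: exI[of _ 1])

lemma computes_distance_code:
  assumes "good_ctx E" "has2 E (\<lambda>x \<beta>. Some (S x (\<beta> 0) (\<lambda>i. \<beta> (Suc i))))"
    and "has3 E (\<lambda>x. osc_contraction (\<Theta> x))"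
    and "computes E n" "computes E c" "computes E k"
    and valid: "\<And>x \<Phi>. E x \<Phi> \<Longrightarrow> unit_rat (c x) \<and> (\<exists>U. baire_valid (S x) U (\<Theta> x))"
  shows "computes E (\<lambda>x. distance_code (S x) (\<Theta> x) (n x) (c x) (k x))"
  unfolding distance_code_def
proof (rule computes_osc_functional[where \<Theta> = \<Theta> and \<alpha> = "\<lambda>x _. c x"])
  show "computes (num_ctx (fun_ctx E)) (\<lambda>z. S (snd (snd z)) (fst z) (\<lambda>i. fst (snd z) (Suc (Suc i))))"
    by (rule computes_seq_obj[OF _ has2_num[OF has2_fun[OF assms(2)]]])
      (intro good_num good_fun computes_num_var
        computes1_weaken_num[OF good_fun computes1_fun_shift] assms)+
  show "computes1 E (\<lambda>x _. c x)"
    unfolding computes1_def by (intro computes_weaken_num assms)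
  show "\<Theta> x (tcode (S x)) (tcode (S x)) (n x) (\<lambda>_. c x) (k x) \<noteq> None" if "E x \<Phi>" for x \<Phi>
    using valid[OF that] baire_valid_defined by blast
qed (intro assms)+

text \<open>The new centre is tested first, because \<open>\<Theta>\<close> may be undefined outside
  the unit interval.\<close>

lemma dec_refines:
  assumes "good_ctx E" "has2 E (\<lambda>x \<beta>. Some (S x (\<beta> 0) (\<lambda>i. \<beta> (Suc i))))"
    and "has3 E (\<lambda>x. osc_contraction (\<Theta> x))"
    and "computes E n" "computes E s" "computes E s'"
    and valid: "\<And>x \<Phi>. E x \<Phi> \<Longrightarrow> \<exists>U. baire_valid (S x) U (\<Theta> x)"
  shows "dec E (\<lambda>x. refines (S x) (\<Theta> x) (n x) (s x) (s' x))"
  unfolding refines_def Let_def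
proof (rule dec_conj_lazy)
  let ?E = "sub_ctx E (\<lambda>x. unit_rat (fst (prod_decode (s' x))))"
  have D: "computes ?E (\<lambda>x. distance_code (S x) (\<Theta> x) (n x) (fst (prod_decode (s' x))) (snd (prod_decode (s' x))))"
    by (rule computes_distance_code[OF _ has2_sub[OF assms(2)] has3_sub[OF assms(3)]])
      ((intro computes_fst_prod_decode computes_snd_prod_decode computes_sub good_sub assms)+,
        use valid in \<open>auto simp: sub_ctx_def\<close>)
  show "dec ?E (\<lambda>x. snd (prod_decode (s x)) < snd (prod_decode (s' x)) \<and>
      rv (radd (fst (prod_decode (s x))) (rhalf (snd (prod_decode (s' x)))))
        \<le> rv (radd (fst (prod_decode (s' x))) (rhalf (snd (prod_decode (s x))))) \<and>
      rv (radd (fst (prod_decode (s' x))) (rhalf (snd (prod_decode (s' x)))))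
        \<le> rv (radd (fst (prod_decode (s x))) (rhalf (snd (prod_decode (s x))))) \<and>
      rv (radd (rhalf (snd (prod_decode (s' x)))) (rhalf (snd (prod_decode (s' x)))))
        < rv (distance_code (S x) (\<Theta> x) (n x) (fst (prod_decode (s' x))) (snd (prod_decode (s' x)))))"
    by (intro dec_conj dec_less dec_rv_le dec_rv_less good_sub assms(1))
      (rule D | intro computes_radd computes_rhalf computes_fst_prod_decode
        computes_snd_prod_decode computes_sub good_sub assms)+
qed (intro dec_unit_rat computes_fst_prod_decode assms)+

lemma computes_interval_seq:
  "computes (num_ctx baire_ctx) (\<lambda>z. interval_seq (fst (snd z)) (snd (snd z)) (fst z))"
  unfolding interval_seq_def
proof (rule computes_rec)
  \<comment> \<open>From the front, the three bound numbers are the step number, the previous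
    interval and the number at which the whole sequence is evaluated.\<close>
  let ?E = "num_ctx (num_ctx (num_ctx baire_ctx))"
  note good = good_num[OF good_num[OF good_num[OF good_baire_ctx]]]
  show "computes ?E (\<lambda>z. LEAST s'. refines (fst (snd (snd (snd z)))) (snd (snd (snd (snd z)))) (fst z) (fst (snd z)) s'
      \<or> \<not> unit_rat (fst (prod_decode (fst (snd z)))))"
  proof (rule computes_Least[OF good])
    show "dec (num_ctx ?E) (\<lambda>z. refines (fst (snd (snd (snd (snd z))))) (snd (snd (snd (snd (snd z))))) (fst (snd z)) (fst (snd (snd z))) (fst z)
      \<or> \<not> unit_rat (fst (prod_decode (fst (snd (snd z))))))"
    proof (intro dec_disj dec_not dec_unit_rat computes_fst_prod_decode good_num good)
      show "dec (num_ctx ?E) (\<lambda>z. refines (fst (snd (snd (snd (snd z))))) (snd (snd (snd (snd (snd z))))) (fst (snd z)) (fst (snd (snd z))) (fst z))"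
        by (rule dec_refines[OF good_num[OF good]
              has2_num[OF has2_num[OF has2_num[OF has2_num[OF has2_baire_ctx]]]]
              has3_num[OF has3_num[OF has3_num[OF has3_num[OF has3_baire_ctx]]]]])
          ((intro computes_intros good_baire_ctx)+, auto simp: num_ctx_def baire_ctx_def)
    qed (intro computes_intros good_baire_ctx)+
    show "\<exists>s'. refines (fst (snd (snd (snd z)))) (snd (snd (snd (snd z)))) (fst z) (fst (snd z)) s'
      \<or> \<not> unit_rat (fst (prod_decode (fst (snd z))))" if "?E z \<Phi>" for z \<Phi>
      using that exists_refines by (fastforce simp: num_ctx_def baire_ctx_def)
  qed
qed (intro computes_intros)+

lemma osc_functional_computes_baire_realiser:
  "\<exists>e. \<forall>\<Theta>. is_osc_functional \<Theta> \<longrightarrow>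
     baire_realiser (\<lambda>S k. kleene e [T0 k, seq_obj S, osc_functional_obj \<Theta>, total2 exists2])"
proof -
  have "computes (num_ctx baire_ctx) (\<lambda>z. fst (prod_decode (interval_seq (fst (snd z)) (snd (snd z)) (fst z))))"
    by (intro computes_fst_prod_decode computes_interval_seq good_num good_baire_ctx)
  from computes_numE[OF this, unfolded fst_conv snd_conv] obtain e where e:
    "\<And>k x \<Phi>. baire_ctx x \<Phi> \<Longrightarrow> kleene_rel e (T0 k # \<Phi>) (fst (prod_decode (interval_seq (fst x) (snd x) k)))"
    by blast
  have "\<exists>\<beta> x. (\<forall>k. kleene e [T0 k, seq_obj S, osc_functional_obj \<Theta>, total2 exists2] = Some (\<beta> k)) \<and>
      codes \<beta> x \<and> x \<in> (\<Inter>n. U n)"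
    if "baire_valid S U \<Theta>" for \<Theta> S U
  proof -
    have "baire_ctx (S, \<Theta>) [seq_obj S, osc_functional_obj \<Theta>, total2 exists2]"
      using that by (auto simp: baire_ctx_def)
    from e[OF this] interval_seq_limit[OF that] show ?thesis
      unfolding kleene_eq_Some_iff fst_conv snd_conv
      by (intro exI[of _ "\<lambda>k. fst (prod_decode (interval_seq S \<Theta> k))"]) blast
  qed
  then show ?thesis unfolding baire_realiser_def baire_valid_def by blast
qed

section \<open>The finiteness realiser\<close>

text \<open>
  The sets of the tower are all equal to the complement of the translate of \<open>X\<close> by \<open>- rv c\<close>.
\<close>

definition shifted_complement :: "type2 \<Rightarrow> nat \<Rightarrow> nat \<Rightarrow> type2" where
  "shifted_complement S c n \<alpha> = 1 - S (\<lambda>i. radd c (\<alpha> i))"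

text \<open>
  Totalised: the output of \<open>\<Theta>\<close> may be undefined off the codes of elements of the unit interval, but
  an argument of \<open>\<Delta>\<close> has to be total.
\<close>

definition avoid_fun :: "type2 \<Rightarrow> osc_functional \<Rightarrow> nat \<Rightarrow> type1 \<Rightarrow> type1" where
  "avoid_fun S \<Theta> c \<alpha> k = (if unit_code \<alpha>
     then the (\<Theta> (tcode (shifted_complement S c)) (tcode (shifted_complement S c)) 0 \<alpha> k) else 0)"

text \<open>A code of \<open>rv c\<close> plus the distance from \<open>rv c\<close> to \<open>X \<inter> {rv c..rv c + 1}\<close>.\<close>

definition next_code :: "type2 \<Rightarrow> osc_functional \<Rightarrow> conv_functional \<Rightarrow> nat \<Rightarrow> type1" where
  "next_code S \<Theta> \<Delta> c k = radd c (the (\<Delta> (avoid_fun S \<Theta> c) (\<lambda>_. rcode 0 0 1) k))"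

text \<open>Since every element of \<open>X\<close> occurs among the candidates, this expresses that
  the first \<open>N\<close> of them exhaust \<open>X\<close>, with quantifiers over numbers only.
  The test on \<open>S\<close> discards candidates off \<open>X\<close>, such as
  \<open>rv m + 1\<close> when no element lies in reach.\<close>

definition covers :: "type2 \<Rightarrow> osc_functional \<Rightarrow> conv_functional \<Rightarrow> nat \<Rightarrow> bool" where
  "covers S \<Theta> \<Delta> N \<longleftrightarrow> (\<forall>m. S (next_code S \<Theta> \<Delta> m) = 1 \<longrightarrow>
     (\<exists>i. i < N \<and> real_eq (next_code S \<Theta> \<Delta> i) (next_code S \<Theta> \<Delta> m)))"

text \<open>All of the first \<open>N\<close> candidates are listed, since a finiteness realiser may
  also list other reals and repetitions.\<close>

definition list_code :: "type2 \<Rightarrow> osc_functional \<Rightarrow> conv_functional \<Rightarrow> type1" where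
  "list_code S \<Theta> \<Delta> j = (if j = 0 then LEAST N. covers S \<Theta> \<Delta> N
     else next_code S \<Theta> \<Delta> (fst (prod_decode (j - 1))) (snd (prod_decode (j - 1))))"

definition fin_valid :: "type2 \<Rightarrow> real set \<Rightarrow> osc_functional \<Rightarrow> conv_functional \<Rightarrow> bool" where
  "fin_valid S X \<Theta> \<Delta> \<longleftrightarrow> is_osc_functional \<Theta> \<and> is_R2_to_R3 \<Delta> \<and> finite X \<and> codes_set S X"

lemma closure_compl_finite: "finite X \<Longrightarrow> closure (- X) = (UNIV :: real set)"
proof -
  assume "finite X"
  then have "interior X = {}" by (rule empty_interior_finite)
  then show ?thesis by (simp add: closure_interior)
qed

lemma translate_Collect: "{x. c + x \<in> X} = (\<lambda>y. y - c) ` X" for c :: real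
proof (rule set_eqI)
  show "x \<in> {x. c + x \<in> X} \<longleftrightarrow> x \<in> (\<lambda>y. y - c) ` X" for x
    by (auto intro!: image_eqI[of _ _ "c + x"])
qed

text \<open>The tower of a constant sequence is the characteristic function of the translated set,
  so level 0 already gives the desired complement.\<close>

lemma fin_valid_R2:
  assumes "fin_valid S X \<Theta> \<Delta>"
  obtains Y where "R2 Y {x \<in> {0..1}. rv c + x \<notin> X}"
    "codes_pfun (\<Theta> (tcode (shifted_complement S c)) (tcode (shifted_complement S c)) 0) Y"
proof -
  let ?X = "{x. rv c + x \<in> X}"
  have fin: "finite ?X" using assms by (simp add: fin_valid_def translate_Collect)
  have S: "shifted_complement S c n \<alpha> = (if x \<in> - ?X then 1 else 0)" if "codes \<alpha> x" for n \<alpha> x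
    using assms codes_radd[OF that, of c]
    by (auto simp: fin_valid_def codes_set_def shifted_complement_def)
  have "is_osc_functional \<Theta>" using assms by (simp add: fin_valid_def)
  then obtain Y where "R2 Y {x \<in> {0..1}. \<forall>i\<le>0::nat. x \<in> - ?X}"
    "codes_pfun (\<Theta> (tcode (shifted_complement S c)) (tcode (shifted_complement S c)) 0) Y"
    using osc_functional_tower[of \<Theta> "\<lambda>_. - ?X" "shifted_complement S c" 0]
      S fin closure_compl_finite[OF fin] by (auto simp: open_Compl finite_imp_closed)
  then show ?thesis using that by auto
qed

lemma fin_valid_defined:
  assumes "fin_valid S X \<Theta> \<Delta>" "unit_code \<alpha>"
  shows "\<Theta> (tcode (shifted_complement S c)) (tcode (shifted_complement S c)) 0 \<alpha> k \<noteq> None"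
proof -
  obtain Y where "codes_pfun (\<Theta> (tcode (shifted_complement S c)) (tcode (shifted_complement S c)) 0) Y"
    using fin_valid_R2[OF assms(1), of c] by blast
  then show ?thesis
    using assms(2) unfolding codes_pfun_def unit_code_iff by (metis option.distinct(1))
qed

lemma fin_valid_R3:
  assumes "fin_valid S X \<Theta> \<Delta>"
  obtains Z where "R3 Z {x \<in> {0..1}. rv c + x \<notin> X}" "codes_pfun (\<Delta> (avoid_fun S \<Theta> c)) Z"
proof -
  let ?U = "{x \<in> {0..1}. rv c + x \<notin> X}"
  obtain Y where Y: "R2 Y ?U"
    "codes_pfun (\<Theta> (tcode (shifted_complement S c)) (tcode (shifted_complement S c)) 0) Y"
    using fin_valid_R2[OF assms] by blast
  have "codes (avoid_fun S \<Theta> c \<alpha>) (Y x)" if x: "x \<in> {0..1}" "codes \<alpha> x" for \<alpha> x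
  proof -
    obtain \<beta> where \<beta>: "\<And>k. \<Theta> (tcode (shifted_complement S c)) (tcode (shifted_complement S c)) 0 \<alpha> k
        = Some (\<beta> k)" "codes \<beta> (Y x)"
      using Y(2) x unfolding codes_pfun_def by blast
    have "unit_code \<alpha>" using x unfolding unit_code_iff by blast
    then have "avoid_fun S \<Theta> c \<alpha> = \<beta>" by (auto simp: avoid_fun_def \<beta>(1))
    with \<beta>(2) show ?thesis by simp
  qed
  then have "codes_fun (avoid_fun S \<Theta> c) Y" unfolding codes_fun_def by blast
  moreover have "openin (top_of_set {0..1}) ?U"
  proof -
    have "closed {x. rv c + x \<in> X}"
      using assms by (intro finite_imp_closed) (simp add: fin_valid_def translate_Collect)
    moreover have "?U = {0..1} \<inter> - {x. rv c + x \<in> X}" by auto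
    ultimately show ?thesis by (metis openin_open_Int open_Compl)
  qed
  ultimately show ?thesis
    using assms Y(1) that unfolding fin_valid_def is_R2_to_R3_def by blast
qed

lemma fin_valid_conv_defined:
  assumes "fin_valid S X \<Theta> \<Delta>"
  shows "\<Delta> (avoid_fun S \<Theta> c) (\<lambda>_. rcode 0 0 1) k \<noteq> None"
proof -
  obtain Z where "codes_pfun (\<Delta> (avoid_fun S \<Theta> c)) Z"
    using fin_valid_R3[OF assms, of c] by blast
  moreover have "rv (rcode 0 0 1) \<in> {0..1}" by (simp add: rv_rcode)
  ultimately show ?thesis
    using codes_const[of "rcode 0 0 1"] unfolding codes_pfun_def by (metis option.distinct(1))
qed

lemma codes_next_code:
  assumes "fin_valid S X \<Theta> \<Delta>"
  obtains Z where "R3 Z {x \<in> {0..1}. rv c + x \<notin> X}" "codes (next_code S \<Theta> \<Delta> c) (rv c + Z 0)"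
proof -
  obtain Z where Z: "R3 Z {x \<in> {0..1}. rv c + x \<notin> X}" "codes_pfun (\<Delta> (avoid_fun S \<Theta> c)) Z"
    using fin_valid_R3[OF assms, of c] by blast
  have "rv (rcode 0 0 1) = 0" by (simp add: rv_rcode)
  then have "codes (\<lambda>_. rcode 0 0 1) 0" using codes_const[of "rcode 0 0 1"] by simp
  then obtain \<beta> where \<beta>: "\<And>k. \<Delta> (avoid_fun S \<Theta> c) (\<lambda>_. rcode 0 0 1) k = Some (\<beta> k)" "codes \<beta> (Z 0)"
    using Z(2) unfolding codes_pfun_def by (metis atLeastAtMost_iff order_refl zero_le_one)
  have "next_code S \<Theta> \<Delta> c = (\<lambda>k. radd c (\<beta> k))"
    by (rule ext) (simp only: next_code_def \<beta>(1) option.sel)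
  with codes_radd[OF \<beta>(2), of c] Z(1) show ?thesis by (intro that) auto
qed

text \<open>A finite set leaves a gap below \<open>x\<close>. From a rational in this gap at
  distance less than 1, the next element of \<open>X\<close> is \<open>x\<close> itself.\<close>

lemma next_code_reaches:
  assumes "fin_valid S X \<Theta> \<Delta>" "x \<in> X"
  shows "\<exists>c. codes (next_code S \<Theta> \<Delta> c) x"
proof -
  have fin: "finite X" using assms(1) by (simp add: fin_valid_def)
  \<comment> \<open>The extra point \<open>x - 1\<close> makes the maximum exist and keeps
    \<open>q\<close> within distance 1 of \<open>x\<close>.\<close>
  let ?B = "insert (x - 1) {y \<in> X. y < x}"
  have B: "finite ?B" "?B \<noteq> {}" using fin by auto
  then have "Max ?B < x" by (subst Max_less_iff) auto
  then obtain q where q: "q \<in> \<rat>" "Max ?B < q" "q < x" using Rats_dense_in_real by blast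
  have below: "y < q" if "y \<in> ?B" for y
    using Max_ge[OF B(1) that] q(2) by linarith
  obtain c where c: "rv c = q" using rv_surj[OF q(1)] by blast
  obtain Z where Z: "R3 Z {t \<in> {0..1}. rv c + t \<notin> X}" "codes (next_code S \<Theta> \<Delta> c) (rv c + Z 0)"
    using codes_next_code[OF assms(1), of c] by blast
  let ?T = "{0..1} - {t \<in> {0..1}. rv c + t \<notin> X}"
  have mem: "x - q \<in> ?T" using below[of "x - 1"] q(3) assms(2) c by auto
  \<comment> \<open>The complement is non-empty, so the default value 1 of (R.3) does not
    apply.\<close>
  then have "Z 0 = infdist 0 ?T" using Z(1) unfolding R3_def by auto
  also have "\<dots> = x - q"
  proof (rule antisym)
    show "infdist 0 ?T \<le> x - q" using infdist_le[OF mem, of 0] q(3) by (simp add: dist_real_def)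
    have "x - q \<le> dist 0 t" if "t \<in> ?T" for t
    proof (rule ccontr)
      assume "\<not> x - q \<le> dist 0 t"
      with that c have "q + t \<in> X" "q + t < x" "0 \<le> t" by (auto simp: dist_real_def)
      with below[of "q + t"] show False by simp
    qed
    then show "x - q \<le> infdist 0 ?T"
      using mem infdist_notempty[of ?T 0] cINF_greatest[of ?T "x - q" "dist 0"]
      by (metis (no_types, lifting) empty_iff)
  qed
  finally show ?thesis using Z(2) c by auto
qed

text \<open>One index is chosen for each of the finitely many elements; any bound on these indices
  works.\<close>

lemma exists_covers:
  assumes "fin_valid S X \<Theta> \<Delta>"
  shows "\<exists>N. covers S \<Theta> \<Delta> N"
proof -
  have fin: "finite X" using assms by (simp add: fin_valid_def)
  have "\<forall>x\<in>X. \<exists>c. codes (next_code S \<Theta> \<Delta> c) x"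
    using next_code_reaches[OF assms] by blast
  then obtain h where h: "\<And>x. x \<in> X \<Longrightarrow> codes (next_code S \<Theta> \<Delta> (h x)) x" by metis
  obtain N where N: "\<And>x. x \<in> X \<Longrightarrow> h x < N"
    using finite_imageI[OF fin, of h] by (auto simp: finite_nat_set_iff_bounded)
  have "\<exists>i. i < N \<and> real_eq (next_code S \<Theta> \<Delta> i) (next_code S \<Theta> \<Delta> m)"
    if "S (next_code S \<Theta> \<Delta> m) = 1" for m
  proof -
    obtain y where y: "codes (next_code S \<Theta> \<Delta> m) y" using codes_next_code[OF assms] by blast
    then have "y \<in> X"
      using that assms unfolding fin_valid_def codes_set_def by (metis zero_neq_one)
    then have "real_eq (next_code S \<Theta> \<Delta> (h y)) (next_code S \<Theta> \<Delta> m)"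
      using real_eq_iff[OF h y] by blast
    with N[OF \<open>y \<in> X\<close>] show ?thesis by blast
  qed
  then show ?thesis unfolding covers_def by blast
qed

lemma list_code_correct:
  assumes "fin_valid S X \<Theta> \<Delta>"
  shows "\<exists>xs. codes_list (list_code S \<Theta> \<Delta>) xs \<and> X \<subseteq> set xs"
proof -
  define N where "N = (LEAST N. covers S \<Theta> \<Delta> N)"
  have N: "covers S \<Theta> \<Delta> N" unfolding N_def using exists_covers[OF assms] by (rule LeastI_ex)
  have "\<forall>c. \<exists>y. codes (next_code S \<Theta> \<Delta> c) y" using codes_next_code[OF assms] by blast
  then obtain r where r: "\<And>c. codes (next_code S \<Theta> \<Delta> c) (r c)" by metis
  have "codes_list (list_code S \<Theta> \<Delta>) (map r [0..<N])"
    unfolding codes_list_def by (auto simp: list_code_def r simp flip: N_def)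
  moreover have "x \<in> r ` {0..<N}" if x: "x \<in> X" for x
  proof -
    obtain m where m: "codes (next_code S \<Theta> \<Delta> m) x" using next_code_reaches[OF assms x] by blast
    then have "S (next_code S \<Theta> \<Delta> m) = 1"
      using assms x unfolding fin_valid_def codes_set_def by simp
    then obtain i where "i < N" "real_eq (next_code S \<Theta> \<Delta> i) (next_code S \<Theta> \<Delta> m)"
      using N unfolding covers_def by blast
    with real_eq_iff[OF r m] show ?thesis by auto
  qed
  ultimately show ?thesis by (intro exI[of _ "map r [0..<N]"]) auto
qed

section \<open>Computability of the list\<close>

definition fin_functionals ::
    "'x ctx \<Rightarrow> ('x \<Rightarrow> type2) \<Rightarrow> ('x \<Rightarrow> osc_functional) \<Rightarrow> ('x \<Rightarrow> conv_functional) \<Rightarrow> bool" where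
  "fin_functionals E S \<Theta> \<Delta> \<longleftrightarrow> good_ctx E \<and> has2 E (\<lambda>x f. Some (S x f)) \<and>
     has3 E (\<lambda>x. osc_contraction (\<Theta> x)) \<and> has3 E (\<lambda>x. conv_contraction (\<Delta> x)) \<and>
     (\<forall>x \<Phi>. E x \<Phi> \<longrightarrow> (\<exists>X. fin_valid (S x) X (\<Theta> x) (\<Delta> x)))"

text \<open>Lets all the standing hypotheses pass below a number quantifier or a search at
  once.\<close>

lemma fin_functionals_num: "fin_functionals E S \<Theta> \<Delta> \<Longrightarrow>
    fin_functionals (num_ctx E) (\<lambda>z. S (snd z)) (\<lambda>z. \<Theta> (snd z)) (\<lambda>z. \<Delta> (snd z))"
  unfolding fin_functionals_def
  by (intro conjI good_num has2_num[where \<Psi> = "\<lambda>x f. Some (S x f)"]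
      has3_num[where \<Psi> = "\<lambda>x. osc_contraction (\<Theta> x)"] has3_num[where \<Psi> = "\<lambda>x. conv_contraction (\<Delta> x)"])
    (auto simp: num_ctx_def)

text \<open>The decidable test \<open>unit_code\<close> comes before the call of
  \<open>\<Theta>\<close>, which makes the result total for use as an argument of
  \<open>\<Delta>\<close>.\<close>

lemma computes_avoid_fun:
  assumes "fin_functionals E S \<Theta> \<Delta>" "computes E c"
  shows "computes (fun_ctx E)
    (\<lambda>z. avoid_fun (S (snd z)) (\<Theta> (snd z)) (c (snd z)) (\<lambda>i. fst z (Suc (Suc i))) (fst z 1))"
  unfolding avoid_fun_def
proof (rule computes_if_lazy)
  have good: "good_ctx E" and S: "has2 E (\<lambda>x f. Some (S x f))"
    and \<Theta>: "has3 E (\<lambda>x. osc_contraction (\<Theta> x))"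
    and valid: "\<And>x \<Phi>. E x \<Phi> \<Longrightarrow> \<exists>X. fin_valid (S x) X (\<Theta> x) (\<Delta> x)"
    using assms(1) by (auto simp: fin_functionals_def)
  show "good_ctx (fun_ctx E)" using good by (rule good_fun)
  show "dec (fun_ctx E) (\<lambda>z. unit_code (\<lambda>i. fst z (Suc (Suc i))))"
    by (intro dec_unit_code computes1_fun_shift good good_fun)
  let ?E = "sub_ctx (fun_ctx E) (\<lambda>z. unit_code (\<lambda>i. fst z (Suc (Suc i))))"
  have goodE: "good_ctx ?E" by (intro good_sub good_fun good)
  show "computes ?E (\<lambda>z. the (\<Theta> (snd z) (tcode (shifted_complement (S (snd z)) (c (snd z))))
      (tcode (shifted_complement (S (snd z)) (c (snd z)))) 0 (\<lambda>i. fst z (Suc (Suc i))) (fst z 1)))"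
  proof (rule computes_osc_functional[where \<Theta> = "\<lambda>z. \<Theta> (snd z)" and n = "\<lambda>z. 0"
        and S = "\<lambda>z. shifted_complement (S (snd z)) (c (snd z))" and k = "\<lambda>z. fst z 1"
        and \<alpha> = "\<lambda>z i. fst z (Suc (Suc i))"])
    show "has3 ?E (\<lambda>z. osc_contraction (\<Theta> (snd z)))"
      by (rule has3_sub[OF has3_fun[OF \<Theta>]])
    \<comment> \<open>From the front, the bound variables are the level of the tower, the query made
      by \<open>\<Theta>\<close> and the query made by \<open>\<Delta>\<close>.\<close>
    let ?E' = "num_ctx (fun_ctx ?E)"
    have goodE': "good_ctx ?E'" by (intro good_num good_fun goodE)
    have "computes1 ?E' (\<lambda>z i. radd (c (snd (snd (snd z)))) (fst (snd z) (Suc (Suc i))))"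
      unfolding computes1_def
    proof (rule computes_radd[OF good_num[OF goodE']])
      show "computes (num_ctx ?E') (\<lambda>z. c (snd (snd (snd (snd z)))))"
        by (rule computes_weaken_num[OF goodE' computes_weaken_num[OF good_fun[OF goodE]
              computes_weaken_fun[OF goodE computes_sub[OF computes_weaken_fun[OF good assms(2)]]]]])
      show "computes (num_ctx ?E') (\<lambda>z. fst (snd (snd z)) (Suc (Suc (fst z))))"
        using computes1_weaken_num[OF good_fun[OF goodE] computes1_fun_shift[OF goodE]]
        unfolding computes1_def .
    qed
    then have "computes ?E' (\<lambda>z. S (snd (snd (snd z))) (\<lambda>i. radd (c (snd (snd (snd z)))) (fst (snd z) (Suc (Suc i)))))"
      by (intro computes_total2[where S = "\<lambda>z. S (snd (snd (snd z)))"] goodE'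
        has2_num[OF has2_fun[OF has2_sub[OF has2_fun[OF S]]]])
    then show "computes ?E' (\<lambda>z. shifted_complement (S (snd (snd (snd z)))) (c (snd (snd (snd z)))) (fst z)
        (\<lambda>i. fst (snd z) (Suc (Suc i))))"
      unfolding shifted_complement_def by (intro computes_diff computes_const goodE')
    show "\<Theta> (snd z) (tcode (shifted_complement (S (snd z)) (c (snd z))))
        (tcode (shifted_complement (S (snd z)) (c (snd z)))) 0 (\<lambda>i. fst z (Suc (Suc i))) (fst z 1) \<noteq> None"
      if z: "?E z \<Phi>" for z \<Phi>
    proof -
      obtain X where "fin_valid (S (snd z)) X (\<Theta> (snd z)) (\<Delta> (snd z))"
        using z valid unfolding sub_ctx_def fun_ctx_def by blast
      then show ?thesis using z fin_valid_defined unfolding sub_ctx_def by blast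
    qed
  qed (intro goodE computes_const computes1_sub computes_sub computes1_fun_shift computes_fun_app good)+
qed (intro computes_const)

lemma computes_next_code:
  assumes "fin_functionals E S \<Theta> \<Delta>" "computes E c" "computes E k"
  shows "computes E (\<lambda>x. next_code (S x) (\<Theta> x) (\<Delta> x) (c x) (k x))"
  unfolding next_code_def
proof (rule computes_radd)
  have valid: "\<And>x \<Phi>. E x \<Phi> \<Longrightarrow> \<exists>X. fin_valid (S x) X (\<Theta> x) (\<Delta> x)"
    using assms(1) by (auto simp: fin_functionals_def)
  show good: "good_ctx E" using assms(1) by (auto simp: fin_functionals_def)
  show "computes E (\<lambda>x. the (\<Delta> x (avoid_fun (S x) (\<Theta> x) (c x)) (\<lambda>_. rcode 0 0 1) (k x)))"
  proof (rule computes_conv_functional[where \<Delta> = \<Delta> and k = k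
        and F = "\<lambda>x. avoid_fun (S x) (\<Theta> x) (c x)" and \<alpha> = "\<lambda>x _. rcode 0 0 1"])
    show "has3 E (\<lambda>x. conv_contraction (\<Delta> x))" using assms(1) by (auto simp: fin_functionals_def)
    show "computes1 E (\<lambda>x _. rcode 0 0 1)" unfolding computes1_def by (rule computes_const)
    show "\<Delta> x (avoid_fun (S x) (\<Theta> x) (c x)) (\<lambda>_. rcode 0 0 1) (k x) \<noteq> None" if "E x \<Phi>" for x \<Phi>
      using valid[OF that] fin_valid_conv_defined by blast
  qed (intro good computes_avoid_fun[OF assms(1,2)] assms(3))+
qed (rule assms(2))

lemma computes1_next_code:
  assumes "fin_functionals E S \<Theta> \<Delta>" "computes E c"
  shows "computes1 E (\<lambda>x. next_code (S x) (\<Theta> x) (\<Delta> x) (c x))"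
proof -
  have "good_ctx E" using assms(1) by (auto simp: fin_functionals_def)
  then show ?thesis
    unfolding computes1_def
    by (rule computes_next_code[OF fin_functionals_num[OF assms(1)] computes_weaken_num[OF _ assms(2)]
          computes_num_var])
qed

lemma dec_covers:
  assumes "fin_functionals E S \<Theta> \<Delta>" "computes E N"
  shows "dec E (\<lambda>x. covers (S x) (\<Theta> x) (\<Delta> x) (N x))"
  unfolding covers_def
proof (rule dec_all)
  show good: "good_ctx E" using assms(1) by (auto simp: fin_functionals_def)
  have F: "fin_functionals (num_ctx E) (\<lambda>z. S (snd z)) (\<lambda>z. \<Theta> (snd z)) (\<lambda>z. \<Delta> (snd z))"
    by (rule fin_functionals_num[OF assms(1)])
  have F': "fin_functionals (num_ctx (num_ctx E)) (\<lambda>z. S (snd (snd z))) (\<lambda>z. \<Theta> (snd (snd z))) (\<lambda>z. \<Delta> (snd (snd z)))"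
    by (rule fin_functionals_num[OF F])
  have g: "good_ctx (num_ctx E)" "good_ctx (num_ctx (num_ctx E))" using good by auto
  have S: "has2 (num_ctx E) (\<lambda>z f. Some (S (snd z) f))" using F by (auto simp: fin_functionals_def)
  have m: "computes1 (num_ctx E) (\<lambda>z. next_code (S (snd z)) (\<Theta> (snd z)) (\<Delta> (snd z)) (fst z))"
    by (rule computes1_next_code[OF F computes_num_var])
  have i: "computes1 (num_ctx (num_ctx E)) (\<lambda>z. next_code (S (snd (snd z))) (\<Theta> (snd (snd z))) (\<Delta> (snd (snd z))) (fst z))"
    by (rule computes1_next_code[OF F' computes_num_var])
  have N: "computes (num_ctx (num_ctx E)) (\<lambda>z. N (snd (snd z)))"
    by (intro computes_weaken_num good g assms)
  show "dec (num_ctx E) (\<lambda>z. S (snd z) (next_code (S (snd z)) (\<Theta> (snd z)) (\<Delta> (snd z)) (fst z)) = 1 \<longrightarrow>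
      (\<exists>i. i < N (snd z) \<and> real_eq (next_code (S (snd z)) (\<Theta> (snd z)) (\<Delta> (snd z)) i)
        (next_code (S (snd z)) (\<Theta> (snd z)) (\<Delta> (snd z)) (fst z))))"
  proof (intro dec_imp[OF g(1)] dec_eq[OF g(1)] dec_ex[OF g(1)] dec_conj[OF g(2)] dec_less[OF g(2)] N
      computes_const computes_num_var dec_real_eq[OF g(2)] i)
    show "computes (num_ctx E) (\<lambda>z. S (snd z) (next_code (S (snd z)) (\<Theta> (snd z)) (\<Delta> (snd z)) (fst z)))"
      by (rule computes_total2[OF g(1) S m])
    show "computes1 (num_ctx (num_ctx E)) (\<lambda>z. next_code (S (snd (snd z))) (\<Theta> (snd (snd z))) (\<Delta> (snd (snd z))) (fst (snd z)))"
      by (rule computes1_weaken_num[OF g(1) m])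
  qed
qed

lemma computes_list_code:
  assumes "fin_functionals E S \<Theta> \<Delta>" "computes E j"
  shows "computes E (\<lambda>x. list_code (S x) (\<Theta> x) (\<Delta> x) (j x))"
proof -
  have good: "good_ctx E" using assms(1) by (auto simp: fin_functionals_def)
  have "computes E (\<lambda>x. LEAST N. covers (S x) (\<Theta> x) (\<Delta> x) N)"
  proof (rule computes_Least[OF good])
    show "dec (num_ctx E) (\<lambda>z. covers (S (snd z)) (\<Theta> (snd z)) (\<Delta> (snd z)) (fst z))"
      by (rule dec_covers[OF fin_functionals_num[OF assms(1)] computes_num_var])
    show "\<exists>N. covers (S x) (\<Theta> x) (\<Delta> x) N" if "E x \<Phi>" for x \<Phi>
      using assms(1) that exists_covers unfolding fin_functionals_def by blast
  qed
  then show ?thesis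
    unfolding list_code_def
    by (intro computes_if dec_eq computes_next_code[OF assms(1)] computes_fst_prod_decode
        computes_snd_prod_decode computes_diff computes_const assms(2) good)
qed

definition fin_ctx :: "(type2 \<times> osc_functional \<times> conv_functional) ctx" where
  "fin_ctx x \<Phi> \<longleftrightarrow> \<Phi> = [total2 (fst x), osc_functional_obj (fst (snd x)),
     conv_functional_obj (snd (snd x)), total2 exists2] \<and>
     (\<exists>X. fin_valid (fst x) X (fst (snd x)) (snd (snd x)))"

lemma fin_functionals_fin_ctx: "fin_functionals fin_ctx fst (\<lambda>x. fst (snd x)) (\<lambda>x. snd (snd x))"
  unfolding fin_functionals_def
proof (intro conjI)
  show "good_ctx fin_ctx"
    unfolding good_ctx_def ctx_length_def has2_def
    by (auto simp: fin_ctx_def total2_def intro!: exI[of _ 3])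
  show "has2 fin_ctx (\<lambda>x f. Some (fst x f))"
    unfolding has2_def by (auto simp: fin_ctx_def total2_def intro!: exI[of _ 0])
  show "has3 fin_ctx (\<lambda>x. osc_contraction (fst (snd x)))"
    unfolding has3_def
    by (auto simp: fin_ctx_def osc_functional_obj_def osc_contraction_def[abs_def] intro!: exI[of _ 1])
  show "has3 fin_ctx (\<lambda>x. conv_contraction (snd (snd x)))"
    unfolding has3_def
    by (auto simp: fin_ctx_def conv_functional_obj_def conv_contraction_def[abs_def] intro!: exI[of _ 2])
qed (auto simp: fin_ctx_def)

lemma osc_functional_computes_finiteness_realiser:
  "\<exists>e. \<forall>\<Theta> \<Delta>. is_osc_functional \<Theta> \<longrightarrow> is_R2_to_R3 \<Delta> \<longrightarrow>
     finiteness_realiser (\<lambda>S k. kleene e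
       [T0 k, total2 S, osc_functional_obj \<Theta>, conv_functional_obj \<Delta>, total2 exists2])"
proof -
  have "computes (num_ctx fin_ctx) (\<lambda>z. list_code (fst (snd z)) (fst (snd (snd z))) (snd (snd (snd z))) (fst z))"
    by (rule computes_list_code[OF fin_functionals_num[OF fin_functionals_fin_ctx] computes_num_var])
  from computes_numE[OF this, unfolded fst_conv snd_conv] obtain e where e:
    "\<And>k x \<Phi>. fin_ctx x \<Phi> \<Longrightarrow> kleene_rel e (T0 k # \<Phi>) (list_code (fst x) (fst (snd x)) (snd (snd x)) k)"
    by blast
  have "\<exists>\<beta> xs. (\<forall>k. kleene e [T0 k, total2 S, osc_functional_obj \<Theta>, conv_functional_obj \<Delta>, total2 exists2]
      = Some (\<beta> k)) \<and> codes_list \<beta> xs \<and> X \<subseteq> set xs"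
    if "fin_valid S X \<Theta> \<Delta>" for S X \<Theta> \<Delta>
  proof -
    have "fin_ctx (S, \<Theta>, \<Delta>) [total2 S, osc_functional_obj \<Theta>, conv_functional_obj \<Delta>, total2 exists2]"
      using that by (auto simp: fin_ctx_def)
    from e[OF this] list_code_correct[OF that] show ?thesis
      unfolding kleene_eq_Some_iff fst_conv snd_conv
      by (intro exI[of _ "list_code S \<Theta> \<Delta>"]) blast
  qed
  then show ?thesis unfolding finiteness_realiser_def fin_valid_def by blast
qed

theorem theorem3p4:
  shows "(\<exists>e. \<forall>\<Theta>. is_osc_functional \<Theta> \<longrightarrow>
            baire_realiser (\<lambda>S k. kleene e
              [T0 k, seq_obj S, osc_functional_obj \<Theta>, total2 exists2]))
       \<and> (\<exists>e. \<forall>\<Theta> \<Delta>. is_osc_functional \<Theta> \<longrightarrow> is_R2_to_R3 \<Delta> \<longrightarrow>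
            finiteness_realiser (\<lambda>S k. kleene e
              [T0 k, total2 S, osc_functional_obj \<Theta>, conv_functional_obj \<Delta>, total2 exists2]))"
  using osc_functional_computes_baire_realiser osc_functional_computes_finiteness_realiser by (rule conjI)

end
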